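(* Let $\Omega\subset\mathbb{R}^{d+1}$ be the closure of an open, connected, bounded $C^2$-domain. For every $\ell>1$ there are constants $c_0,C_1>0$, depending only on $d$, $\ell$ and $\Omega$, such that for every positive integer $n$ there exist a finite $\frac1n$-separated subset $\{\xi_j\}_{j=1}^{m_n}$ of $\Omega$ with respect to the metric $\rho_\Omega$, and polynomials $P_1,\dots,P_{m_n}$ on $\mathbb{R}^{d+1}$ of total degree at most $c_0n$, such that for every $\xi\in\Omega$, $$\sum_{j=1}^{m_n}P_j(\xi)=1\quad\text{and}\quad |P_j(\xi)|\le C_1\bigl(1+n\rho_\Omega(\xi,\xi_j)\bigr)^{-\ell},\quad j=1,\dots,m_n.$$
   Context: Here $d\ge1$, $\Gamma=\partial\Omega$, $\|\cdot\|$ is the Euclidean norm and $\rho_\Omega(\xi,\eta)=\|\xi-\eta\|+\bigl|\sqrt{\mathrm{dist}(\xi,\Gamma)}-\sqrt{\mathrm{dist}(\eta,\Gamma)}\bigr|$ for $\xi,\eta\in\Omega$. A set $\Lambda$ in a metric space $(X,\rho)$ is $\varepsilon$-separated if $\rho(\omega,\omega')\ge\varepsilon$ for any two distinct $\omega,\omega'\in\Lambda$. $C^2$-domain: a bounded domain for which there are $\delta>0$, $M>0$ and a finite cover of the boundary by connected open sets $U_1,\dots,U_J$ such that (i) every $x$ in the domain with distance $<\delta$ to the boundary lies in some $U_j$ with $\mathrm{dist}(x,\partial U_j)>\delta$; (ii) for each $j$ there is a Cartesian coordinate system $(\xi_{j,1},\dots,\xi_{j,d+1})$ in $U_j$ in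 which the part of the domain in $U_j$ is given by $\xi_{j,d+1}\le f_j(\xi_{j,1},\dots,\xi_{j,d})$ with $f_j\in C^2(\mathbb{R}^d)$ and $\max_{i,k}\|\partial_i\partial_kf_j\|_\infty\le M$. *)

theory Defs
  imports "HOL-Analysis.Analysis"
begin

text \<open>Throughout, \<open>\<real>\<^sup>d\<^sup>+\<^sup>1\<close> is \<open>(real ^ 'd) \<times> real\<close> with its (Euclidean) product norm, so that \<open>snd\<close>
  is the last coordinate and \<open>d = CARD('d) \<ge> 1\<close>.\<close>

definition partial_deriv :: "'d::finite \<Rightarrow> (real ^ 'd \<Rightarrow> real) \<Rightarrow> real ^ 'd \<Rightarrow> real" where
  "partial_deriv i f x = frechet_derivative f (at x) (axis i 1)"

definition C1_function :: "(real ^ 'd::finite \<Rightarrow> real) \<Rightarrow> bool" where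
  "C1_function f \<longleftrightarrow>
     (\<forall>x. f differentiable (at x)) \<and> (\<forall>i. continuous_on UNIV (partial_deriv i f))"

definition C2_function :: "(real ^ 'd::finite \<Rightarrow> real) \<Rightarrow> bool" where
  "C2_function f \<longleftrightarrow> C1_function f \<and> (\<forall>i. C1_function (partial_deriv i f))"

text \<open>The local description by a non-strict inequality includes the boundary points, so the
  condition is one on the closed domain: no nonempty bounded open set satisfies it. For the
  closure of a connected bounded open set, it is equivalent to the condition with
  strict inequality on the interior.

  A Cartesian coordinate system is given by an orthogonal map \<open>R\<close> and an origin \<open>v\<close>; the coordinate
  vector of \<open>x\<close> is \<open>R (x - v)\<close>.\<close>

definition C2_domain :: "((real ^ 'd::finite) \<times> real) set \<Rightarrow> bool" where
  "C2_domain \<Omega> \<longleftrightarrow> bounded \<Omega> \<and>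
     (\<exists>\<delta>>0. \<exists>M>0. \<exists>(J::nat) (U :: nat \<Rightarrow> ((real ^ 'd) \<times> real) set).
        (\<forall>j\<in>{1..J}. open (U j) \<and> connected (U j)) \<and>
        frontier \<Omega> \<subseteq> (\<Union>j\<in>{1..J}. U j) \<and>
        (\<forall>x\<in>\<Omega>. infdist x (frontier \<Omega>) < \<delta> \<longrightarrow>
           (\<exists>j\<in>{1..J}. x \<in> U j \<and> infdist x (frontier (U j)) > \<delta>)) \<and>
        (\<forall>j\<in>{1..J}. \<exists>(R :: (real ^ 'd) \<times> real \<Rightarrow> (real ^ 'd) \<times> real) v (f :: real ^ 'd \<Rightarrow> real).
           orthogonal_transformation R \<and> C2_function f \<and>
           (\<forall>i k x. \<bar>partial_deriv i (partial_deriv k f) x\<bar> \<le> M) \<and>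
           \<Omega> \<inter> U j = {x \<in> U j. snd (R (x - v)) \<le> f (fst (R (x - v)))}))"

definition rho :: "'a::euclidean_space set \<Rightarrow> 'a \<Rightarrow> 'a \<Rightarrow> real" where
  "rho \<Omega> \<xi> \<eta> = norm (\<xi> - \<eta>) +
     \<bar>sqrt (infdist \<xi> (frontier \<Omega>)) - sqrt (infdist \<eta> (frontier \<Omega>))\<bar>"

lemma Metric_space_rho: "Metric_space \<Omega> (rho \<Omega>)"
proof
  fix x y z
  show "0 \<le> rho \<Omega> x y" by (simp add: rho_def)
  show "rho \<Omega> x y = rho \<Omega> y x" by (simp add: rho_def norm_minus_commute abs_minus_commute)
  show "rho \<Omega> x y = 0 \<longleftrightarrow> x = y"
    by (auto simp: rho_def add_nonneg_eq_0_iff)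
  show "rho \<Omega> x z \<le> rho \<Omega> x y + rho \<Omega> y z"
    using norm_triangle_ineq[of "x - y" "y - z"] by (simp add: rho_def)
qed

definition separated_wrt :: "('a \<Rightarrow> 'a \<Rightarrow> real) \<Rightarrow> real \<Rightarrow> 'a set \<Rightarrow> bool" where
  "separated_wrt \<rho> \<epsilon> \<Lambda> \<longleftrightarrow> (\<forall>\<omega>\<in>\<Lambda>. \<forall>\<omega>'\<in>\<Lambda>. \<omega> \<noteq> \<omega>' \<longrightarrow> \<rho> \<omega> \<omega>' \<ge> \<epsilon>)"

text \<open>A multi-index \<open>\<alpha>\<close> is a function on the standard basis; its values elsewhere are irrelevant.
  The degree bound \<open>r\<close> is real.\<close>

definition polynomial_degree_le :: "real \<Rightarrow> ('a::euclidean_space \<Rightarrow> real) \<Rightarrow> bool" where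
  "polynomial_degree_le r p \<longleftrightarrow>
     (\<exists>A (c :: ('a \<Rightarrow> nat) \<Rightarrow> real). finite A \<and> (\<forall>\<alpha>\<in>A. real (\<Sum>b\<in>Basis. \<alpha> b) \<le> r) \<and>
        p = (\<lambda>x. \<Sum>\<alpha>\<in>A. c \<alpha> * (\<Prod>b\<in>Basis. (x \<bullet> b) ^ \<alpha> b)))"

end

theory Submission
  imports Defs
begin

text \<open>Everything is built from one univariate object. Powers of the Fejer kernel, translated to equidistant
nodes, sum to a constant; averaged over \<open>t\<close> and \<open>- t\<close>, they become polynomials in \<open>u = cos t\<close> of degree
proportional to \<open>n\<close>. This gives a partition of unity on \<open>[-1, 1]\<close> that is localized at scale \<open>1 / n\<close>
in the variable \<open>sqrt ((1 - u) / 2)\<close> (\<open>localized_partition_exists\<close>). Up to a factor, this is the square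
root of the distance to the endpoint \<open>u = 1\<close>, which is how the metric behaves at the boundary.

Near a boundary point the set has the form \<open>t \<le> f y\<close> in suitable coordinates. There the metric is bounded
by a multiple of \<open>\<bar>y - y'\<bar> + \<bar>sqrt (depth x) - sqrt (depth x')\<bar>\<close>, where \<open>depth x = f y - t\<close>
(\<open>rho_le_chart_dist\<close>; this uses that the gradient of \<open>f\<close> is Lipschitz). A product of univariate
partitions in the coordinates \<open>y\<close> and in the depth would be localized for this quantity, but the depth is
not a polynomial. At a tangential node \<open>w\<close> it is replaced by the quadratic polynomial
\<open>f w + G w \<bullet> (y - w) + M \<bar>y - w\<bar>\<^sup>2 - t\<close>, which lies between the depth and the depth plus
\<open>2 M \<bar>y - w\<bar>\<^sup>2\<close>. Taking square roots, the error is at most a multiple of \<open>\<bar>y - w\<bar>\<close> and is covered by the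
tangential decay (\<open>chart_partition\<close>). Interior points have charts as well, with a constant \<open>f\<close>.

Outside its chart such a partition may grow, but only exponentially in \<open>n\<close>. Binomial tail probabilities
are polynomial cutoffs which are exponentially exact, at any rate (\<open>step_polynomial\<close>), so finitely many
local partitions can be glued: the products \<open>s j * (\<Prod>i<j. 1 - s i)\<close> of cutoffs telescope to 1 up to an
exponentially small remainder (\<open>glue_local_partitions\<close>). Finally, the polynomials are regrouped along a
maximal separated set of their sites (\<open>separated_partition\<close>). The decay is carried through all steps as a
bound on the weighted sum of all polynomials of a family, so that the regrouping needs no count of the
sites near a given point.\<close>

section \<open>Polynomials of bounded degree\<close>

text \<open>A family of monomials may repeat multi-indices; collecting equal ones brings it into the form
required by the definition. Sums and products of polynomials reduce to this.\<close>

lemma degree_le_family: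
  assumes "finite I" and "\<And>i. i \<in> I \<Longrightarrow> real (\<Sum>b\<in>Basis. \<alpha> i b) \<le> r"
  shows "polynomial_degree_le r (\<lambda>x::'a::euclidean_space. \<Sum>i\<in>I. c i * (\<Prod>b\<in>Basis. (x \<bullet> b) ^ \<alpha> i b))"
proof -
  define A where "A = \<alpha> ` I"
  define c' where "c' = (\<lambda>\<beta>. \<Sum>i\<in>{i\<in>I. \<alpha> i = \<beta>}. c i)"
  have "(\<Sum>i\<in>I. c i * (\<Prod>b\<in>Basis. (x \<bullet> b) ^ \<alpha> i b))
      = (\<Sum>\<beta>\<in>A. c' \<beta> * (\<Prod>b\<in>Basis. (x \<bullet> b) ^ \<beta> b))" for x :: 'a
  proof -
    have "(\<Sum>i\<in>I. c i * (\<Prod>b\<in>Basis. (x \<bullet> b) ^ \<alpha> i b))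
      = (\<Sum>\<beta>\<in>A. \<Sum>i\<in>{i\<in>I. \<alpha> i = \<beta>}. c i * (\<Prod>b\<in>Basis. (x \<bullet> b) ^ \<alpha> i b))"
      unfolding A_def by (rule sum.image_gen[OF assms(1)])
    also have "\<dots> = (\<Sum>\<beta>\<in>A. c' \<beta> * (\<Prod>b\<in>Basis. (x \<bullet> b) ^ \<beta> b))"
      by (intro sum.cong refl) (simp add: c'_def sum_distrib_right)
    finally show ?thesis .
  qed
  then show ?thesis
    unfolding polynomial_degree_le_def using assms
    by (intro exI[of _ A] exI[of _ c']) (auto simp: A_def)
qed

lemma degree_le_mono: "polynomial_degree_le r p \<Longrightarrow> r \<le> s \<Longrightarrow> polynomial_degree_le s p"
  unfolding polynomial_degree_le_def by (elim exE conjE, rule exI, rule exI) (auto intro: order_trans)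

lemma degree_le_const: "0 \<le> r \<Longrightarrow> polynomial_degree_le r (\<lambda>x::'a::euclidean_space. c)"
  using degree_le_family[of "{()}" "\<lambda>_ _. 0" r "\<lambda>_. c"] by simp

lemma degree_le_inner_Basis:
  assumes "1 \<le> r" "u \<in> Basis"
  shows "polynomial_degree_le r (\<lambda>x::'a::euclidean_space. x \<bullet> u)"
proof -
  have "(\<Prod>b\<in>Basis. (x \<bullet> b) ^ (if b = u then 1 else 0)) = x \<bullet> u" for x :: 'a
  proof -
    have "(\<Prod>b\<in>Basis. (x \<bullet> b) ^ (if b = u then 1 else 0))
      = (\<Prod>b\<in>Basis. if b = u then x \<bullet> b else 1)"
      by (intro prod.cong) auto
    then show ?thesis using assms by simp
  qed
  then show ?thesis
    using degree_le_family[of "{()}" "\<lambda>_ b. if b = u then 1 else 0" r "\<lambda>_. 1"] assms by simp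
qed

lemma degree_le_add:
  assumes "polynomial_degree_le r p" "polynomial_degree_le r q"
  shows "polynomial_degree_le r (\<lambda>x::'a::euclidean_space. p x + q x)"
proof -
  obtain A c where A: "finite A" "\<And>\<alpha>. \<alpha> \<in> A \<Longrightarrow> real (\<Sum>b\<in>Basis. \<alpha> b) \<le> r"
    "p = (\<lambda>x. \<Sum>\<alpha>\<in>A. c \<alpha> * (\<Prod>b\<in>Basis. (x \<bullet> b) ^ \<alpha> b))"
    using assms(1) unfolding polynomial_degree_le_def by blast
  obtain B d where B: "finite B" "\<And>\<alpha>. \<alpha> \<in> B \<Longrightarrow> real (\<Sum>b\<in>Basis. \<alpha> b) \<le> r"
    "q = (\<lambda>x. \<Sum>\<alpha>\<in>B. d \<alpha> * (\<Prod>b\<in>Basis. (x \<bullet> b) ^ \<alpha> b))"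
    using assms(2) unfolding polynomial_degree_le_def by blast
  have "polynomial_degree_le r (\<lambda>x::'a. \<Sum>i\<in>A <+> B. case_sum c d i *
      (\<Prod>b\<in>Basis. (x \<bullet> b) ^ case_sum (\<lambda>\<alpha>. \<alpha>) (\<lambda>\<alpha>. \<alpha>) i b))"
    using A B by (intro degree_le_family) auto
  then show ?thesis
    using A B by (simp add: sum.Plus)
qed

lemma degree_le_mult:
  assumes "polynomial_degree_le r p" "polynomial_degree_le s q"
  shows "polynomial_degree_le (r + s) (\<lambda>x::'a::euclidean_space. p x * q x)"
proof -
  obtain A c where A: "finite A" "\<And>\<alpha>. \<alpha> \<in> A \<Longrightarrow> real (\<Sum>b\<in>Basis. \<alpha> b) \<le> r"
    "p = (\<lambda>x. \<Sum>\<alpha>\<in>A. c \<alpha> * (\<Prod>b\<in>Basis. (x \<bullet> b) ^ \<alpha> b))"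
    using assms(1) unfolding polynomial_degree_le_def by blast
  obtain B d where B: "finite B" "\<And>\<alpha>. \<alpha> \<in> B \<Longrightarrow> real (\<Sum>b\<in>Basis. \<alpha> b) \<le> s"
    "q = (\<lambda>x. \<Sum>\<alpha>\<in>B. d \<alpha> * (\<Prod>b\<in>Basis. (x \<bullet> b) ^ \<alpha> b))"
    using assms(2) unfolding polynomial_degree_le_def by blast
  have "polynomial_degree_le (r + s) (\<lambda>x::'a. \<Sum>i\<in>A \<times> B. (c (fst i) * d (snd i)) *
      (\<Prod>b\<in>Basis. (x \<bullet> b) ^ (fst i b + snd i b)))"
  proof (intro degree_le_family)
    fix i assume "i \<in> A \<times> B"
    then show "real (\<Sum>b\<in>Basis. fst i b + snd i b) \<le> r + s"
      using A(2)[of "fst i"] B(2)[of "snd i"] by (auto simp: sum.distrib)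
  qed (use A B in auto)
  moreover have "(\<Sum>i\<in>A \<times> B. (c (fst i) * d (snd i)) *
      (\<Prod>b\<in>Basis. (x \<bullet> b) ^ (fst i b + snd i b))) = p x * q x" for x
    unfolding A(3) B(3)
    by (simp add: sum_product sum.cartesian_product power_add prod.distrib case_prod_unfold algebra_simps)
  ultimately show ?thesis by simp
qed

lemma degree_le_cmult: "polynomial_degree_le r p \<Longrightarrow> polynomial_degree_le r (\<lambda>x::'a::euclidean_space. c * p x)"
  using degree_le_mult[OF degree_le_const[of 0 c]] by auto

lemma degree_le_diff:
  assumes "polynomial_degree_le r p" "polynomial_degree_le r q"
  shows "polynomial_degree_le r (\<lambda>x::'a::euclidean_space. p x - q x)"
  using degree_le_add[OF assms(1) degree_le_cmult[OF assms(2), of "-1"]] by simp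

lemma degree_le_sum:
  assumes "0 \<le> r" "\<And>i. i \<in> I \<Longrightarrow> polynomial_degree_le r (p i)"
  shows "polynomial_degree_le r (\<lambda>x::'a::euclidean_space. \<Sum>i\<in>I. p i x)"
proof (cases "finite I")
  case True
  then show ?thesis using assms(2)
    by (induction I rule: finite_induct) (auto intro: degree_le_const degree_le_add assms(1))
next
  case False
  then show ?thesis using degree_le_const[OF assms(1)] by simp
qed

lemma degree_le_prod:
  assumes "finite I" "\<And>i. i \<in> I \<Longrightarrow> polynomial_degree_le r (p i)"
  shows "polynomial_degree_le (real (card I) * r) (\<lambda>x::'a::euclidean_space. \<Prod>i\<in>I. p i x)"
  using assms
proof (induction I rule: finite_induct)
  case (insert j I)
  then show ?case
    using degree_le_mult[of r "p j" "real (card I) * r" "\<lambda>x. \<Prod>i\<in>I. p i x"]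
    by (auto simp: algebra_simps)
qed (simp add: degree_le_const)

lemma degree_le_poly:
  assumes "polynomial_degree_le r g" "degree q \<le> k" "0 \<le> r"
  shows "polynomial_degree_le (real k * r) (\<lambda>x::'a::euclidean_space. poly q (g x))"
proof -
  have pw: "polynomial_degree_le (real i * r) (\<lambda>x. g x ^ i)" for i
    using degree_le_prod[of "{..<i}" r "\<lambda>_. g"] assms(1) by simp
  have "polynomial_degree_le (real k * r) (\<lambda>x. \<Sum>i\<le>degree q. coeff q i * g x ^ i)"
  proof (intro degree_le_sum degree_le_cmult)
    fix i assume "i \<in> {..degree q}"
    then have "real i * r \<le> real k * r" using assms by (intro mult_right_mono) auto
    then show "polynomial_degree_le (real k * r) (\<lambda>x. g x ^ i)" using pw degree_le_mono by blast
  qed (use assms in auto)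
  then show ?thesis by (simp add: poly_altdef)
qed

lemma degree_le_inner: "1 \<le> r \<Longrightarrow> polynomial_degree_le r (\<lambda>x::'a::euclidean_space. x \<bullet> u)"
proof -
  assume r: "1 \<le> r"
  have "polynomial_degree_le r (\<lambda>x::'a. \<Sum>b\<in>Basis. (u \<bullet> b) * (x \<bullet> b))"
    using r by (intro degree_le_sum degree_le_cmult degree_le_inner_Basis) auto
  then show ?thesis by (simp add: euclidean_inner[of _ u] mult.commute)
qed

text \<open>The coordinates of a chart are of this form, with \<open>A\<close> a component of the orthogonal map.\<close>

lemma degree_le_affine:
  assumes "linear (A :: 'a::euclidean_space \<Rightarrow> real)" "1 \<le> r"
  shows "polynomial_degree_le r (\<lambda>x. A (x - v))"
proof -
  have "A (x - v) = x \<bullet> adjoint A 1 - A v" for x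
    using adjoint_works[OF assms(1), of x 1] linear_diff[OF assms(1)] by (simp add: inner_commute)
  then show ?thesis using degree_le_diff[OF degree_le_inner degree_le_const] assms(2) by simp
qed

section \<open>A localized partition of unity on an interval\<close>

fun chebyshev :: "nat \<Rightarrow> real poly" where
  "chebyshev 0 = 1"
| "chebyshev (Suc 0) = [:0, 1:]"
| "chebyshev (Suc (Suc k)) = [:0, 2:] * chebyshev (Suc k) - chebyshev k"

lemma poly_chebyshev_cos: "poly (chebyshev k) (cos t) = cos (real k * t)"
proof (induction k rule: chebyshev.induct)
  case (3 k)
  have "cos (real (Suc (Suc k)) * t) = 2 * cos t * cos (real (Suc k) * t) - cos (real k * t)"
    using cos_plus_cos[of "real (Suc (Suc k)) * t" "real k * t"] cos_add[of "real (Suc k) * t" t]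
      cos_diff[of "real (Suc k) * t" t] by (simp add: algebra_simps)
  then show ?case using 3 by (simp add: algebra_simps)
qed auto

lemma degree_chebyshev: "degree (chebyshev k) \<le> k"
proof (induction k rule: chebyshev.induct)
  case (3 k)
  have "degree ([:0, 2:] * chebyshev (Suc k)) \<le> Suc (Suc k)"
    using degree_mult_le[of "[:0, 2:]" "chebyshev (Suc k)"] 3 by simp
  then show ?case using 3 by (auto intro!: degree_diff_le)
qed auto

text \<open>The radius 3 is where arguments \<open>1 - 2 s\<close> with \<open>\<bar>s\<bar> \<le> 1\<close> lie; the partitions of unity will
be evaluated there outside the charts, where \<open>s\<close> may be negative. The three-term recursion gives
\<open>6 \<cdot> 7 + 1 \<le> 49\<close>.\<close>

lemma chebyshev_growth: "\<bar>u\<bar> \<le> 3 \<Longrightarrow> \<bar>poly (chebyshev k) u\<bar> \<le> 7 ^ k"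
proof (induction k rule: chebyshev.induct)
  case (3 k)
  have "\<bar>poly (chebyshev (Suc (Suc k))) u\<bar> \<le> \<bar>2 * u * poly (chebyshev (Suc k)) u\<bar> + \<bar>poly (chebyshev k) u\<bar>"
    by (simp add: algebra_simps)
  also have "\<dots> \<le> 6 * 7 ^ Suc k + 7 ^ k"
  proof (rule add_mono)
    have "\<bar>2 * u\<bar> * \<bar>poly (chebyshev (Suc k)) u\<bar> \<le> 6 * 7 ^ Suc k"
      using 3 by (intro mult_mono) auto
    then show "\<bar>2 * u * poly (chebyshev (Suc k)) u\<bar> \<le> 6 * 7 ^ Suc k" by (simp only: abs_mult)
  qed (use 3 in auto)
  also have "\<dots> \<le> 7 ^ Suc (Suc k)" by simp
  finally show ?case .
qed auto

text \<open>Even trigonometric polynomials with nonnegative coefficients. Nonnegativity makes the value at 0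
the sum of the coefficients, which turns bounds for Chebyshev polynomials into bounds for the
corresponding algebraic polynomial.\<close>

definition cosine_polynomials :: "nat \<Rightarrow> (real \<Rightarrow> real) set" where
  "cosine_polynomials k =
     {J. \<exists>a. (\<forall>i. 0 \<le> a i) \<and> (\<forall>t. J t = (\<Sum>i\<le>k. a i * cos (real i * t)))}"

lemma cosine_polynomials_family:
  assumes "finite I" "\<And>i. i \<in> I \<Longrightarrow> \<kappa> i \<le> k" "\<And>i. i \<in> I \<Longrightarrow> 0 \<le> c i"
  shows "(\<lambda>t. \<Sum>i\<in>I. c i * cos (real (\<kappa> i) * t)) \<in> cosine_polynomials k"
proof -
  define a where "a = (\<lambda>j. \<Sum>i\<in>{i\<in>I. \<kappa> i = j}. c i)"
  have "(\<Sum>i\<in>I. c i * cos (real (\<kappa> i) * t)) = (\<Sum>j\<le>k. a j * cos (real j * t))" for t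
  proof -
    have "(\<Sum>i\<in>I. c i * cos (real (\<kappa> i) * t))
        = (\<Sum>j\<le>k. \<Sum>i\<in>{i\<in>I. \<kappa> i = j}. c i * cos (real (\<kappa> i) * t))"
      by (rule sum.group[symmetric]) (use assms in auto)
    also have "\<dots> = (\<Sum>j\<le>k. a j * cos (real j * t))"
      by (intro sum.cong refl) (simp add: a_def sum_distrib_right)
    finally show ?thesis .
  qed
  moreover have "0 \<le> a i" for i using assms(3) by (auto simp: a_def intro: sum_nonneg)
  ultimately show ?thesis unfolding cosine_polynomials_def by blast
qed

lemma cosine_polynomials_mult:
  assumes "f \<in> cosine_polynomials k" "g \<in> cosine_polynomials l"
  shows "(\<lambda>t. f t * g t) \<in> cosine_polynomials (k + l)"
proof -
  obtain a where a: "\<And>i. 0 \<le> a i" "\<And>t. f t = (\<Sum>i\<le>k. a i * cos (real i * t))"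
    using assms(1) unfolding cosine_polynomials_def by blast
  obtain b where b: "\<And>i. 0 \<le> b i" "\<And>t. g t = (\<Sum>i\<le>l. b i * cos (real i * t))"
    using assms(2) unfolding cosine_polynomials_def by blast
  define \<kappa> :: "nat \<times> nat \<times> bool \<Rightarrow> nat" where
    "\<kappa> = (\<lambda>(i, j, s). if s then i + j else (if j \<le> i then i - j else j - i))"
  define c where "c = (\<lambda>(i, j, s::bool). a i * b j / 2)"
  have *: "(\<Sum>s\<in>UNIV. c (i, j, s) * cos (real (\<kappa> (i, j, s)) * t))
      = (a i * cos (real i * t)) * (b j * cos (real j * t))" for i j t
  proof -
    have "cos (real (\<kappa> (i, j, False)) * t) = cos (real i * t - real j * t)"
    proof (cases "j \<le> i")
      case True
      then show ?thesis by (simp add: \<kappa>_def of_nat_diff algebra_simps)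
    next
      case False
      then have "cos (real (\<kappa> (i, j, False)) * t) = cos (- (real i * t - real j * t))"
        by (simp add: \<kappa>_def of_nat_diff algebra_simps)
      then show ?thesis by (simp only: cos_minus)
    qed
    moreover have "cos (real (\<kappa> (i, j, True)) * t) = cos (real i * t + real j * t)"
      by (simp add: \<kappa>_def algebra_simps)
    ultimately show ?thesis
      by (simp add: UNIV_bool c_def cos_diff cos_add ring_distribs flip: add_divide_distrib)
  qed
  have "(\<lambda>t. \<Sum>i\<in>{..k} \<times> {..l} \<times> UNIV. c i * cos (real (\<kappa> i) * t)) \<in> cosine_polynomials (k + l)"
    by (rule cosine_polynomials_family) (auto simp: \<kappa>_def c_def a b)
  moreover have "(\<Sum>i\<in>{..k} \<times> {..l} \<times> UNIV. c i * cos (real (\<kappa> i) * t)) = f t * g t" for t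
  proof -
    have "f t * g t = (\<Sum>i\<le>k. \<Sum>j\<le>l. \<Sum>s\<in>UNIV. c (i, j, s) * cos (real (\<kappa> (i, j, s)) * t))"
      unfolding a(2) b(2) sum_product * ..
    then show ?thesis by (simp only: sum.cartesian_product case_prod_unfold prod.collapse)
  qed
  ultimately show ?thesis by simp
qed

lemma cosine_polynomials_power:
  assumes "f \<in> cosine_polynomials k"
  shows "(\<lambda>t. f t ^ r) \<in> cosine_polynomials (r * k)"
proof (induction r)
  case 0
  then show ?case using cosine_polynomials_family[of "{()}" "\<lambda>_. 0" 0 "\<lambda>_. 1"] by simp
next
  case (Suc r)
  then show ?case using cosine_polynomials_mult[OF assms Suc] by (simp add: algebra_simps)
qed

text \<open>Orthogonality of characters: the translates of \<open>cos (i t)\<close> sum to the real part of a full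
geometric sum of roots of unity. Hence the translates of a trigonometric polynomial of degree
less than \<open>N\<close> to \<open>N\<close> equidistant nodes sum to a constant.\<close>

lemma sum_cos_equidistant:
  fixes i :: int
  assumes "\<bar>i\<bar> < int N"
  shows "(\<Sum>m<N. cos (of_int i * (t - 2 * pi * real m / real N))) = (if i = 0 then real N else 0)"
proof (cases "i = 0")
  case False
  have N: "0 < N" using assms by auto
  define z where "z = cis (- 2 * pi * of_int i / real N)"
  have zm: "z ^ m = cis (- of_int i * (2 * pi * real m / real N))" for m
    unfolding z_def Complex.DeMoivre by (simp add: field_simps)
  have "z ^ N = 1"
    unfolding zm using N cis_multiple_2pi[of "- of_int i"] by (simp add: mult.commute)
  moreover have "z \<noteq> 1"
  proof
    assume "z = 1"
    then have "cos (2 * pi * of_int i / real N) = 1"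
      by (simp add: z_def complex_eq_iff)
    then obtain k :: int where k: "2 * pi * of_int i / real N = of_int k * 2 * pi"
      using cos_one_2pi_int by auto
    then have "real_of_int i = real_of_int (k * int N)" using N by (simp add: field_simps)
    then have "i = k * int N" by linarith
    then show False using assms False N
      by (metis abs_mult abs_of_nat dvd_triv_right zdvd_imp_le dvd_abs_iff not_less zero_less_abs_iff)
  qed
  ultimately have "(\<Sum>m<N. z ^ m) = 0" by (simp add: geometric_sum)
  then have "(\<Sum>m<N. cis (of_int i * t) * z ^ m) = 0" by (simp flip: sum_distrib_left)
  then have "Re (\<Sum>m<N. cis (of_int i * t) * z ^ m) = 0" by simp
  moreover have "Re (cis (of_int i * t) * z ^ m) = cos (of_int i * (t - 2 * pi * real m / real N))" for m
    unfolding zm cis_mult by (simp add: algebra_simps)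
  ultimately show ?thesis using False by (simp add: Re_sum)
qed (simp)

text \<open>The unnormalized Fejer kernel, \<open>(sin (n t / 2) / sin (t / 2))\<^sup>2\<close>; this form also has the
right value at \<open>t = 0\<close>.\<close>

definition fejer :: "nat \<Rightarrow> real \<Rightarrow> real" where
  "fejer n t = (cmod (\<Sum>k<n. cis (real k * t)))\<^sup>2"

lemma fejer_double_sum: "fejer n t = (\<Sum>j<n. \<Sum>k<n. cos (of_int (int j - int k) * t))"
proof -
  have "complex_of_real (fejer n t) = (\<Sum>j<n. cis (real j * t)) * cnj (\<Sum>k<n. cis (real k * t))"
    unfolding fejer_def by (rule complex_norm_square)
  also have "\<dots> = (\<Sum>j<n. \<Sum>k<n. cis (of_int (int j - int k) * t))"
    by (simp add: sum_product cis_cnj cis_mult algebra_simps)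
  finally have "Re (complex_of_real (fejer n t)) = Re (\<Sum>j<n. \<Sum>k<n. cis (of_int (int j - int k) * t))"
    by (rule arg_cong)
  then show ?thesis by (simp add: Re_sum)
qed

lemma fejer_nonneg: "0 \<le> fejer n t" by (simp add: fejer_def)

lemma fejer_le: "fejer n t \<le> (real n)\<^sup>2"
proof -
  have "cmod (\<Sum>k<n. cis (real k * t)) \<le> real n"
    using norm_sum[of "\<lambda>k. cis (real k * t)" "{..<n}"] by simp
  then show ?thesis unfolding fejer_def by (intro power_mono) auto
qed

lemma fejer_0: "fejer n 0 = (real n)\<^sup>2" by (simp add: fejer_def)

lemma fejer_sin_le: "fejer n t * (sin (t / 2))\<^sup>2 \<le> 1"
proof -
  have "(1 - cis t) * (\<Sum>k<n. cis t ^ k) = 1 - cis t ^ n"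
    by (metis one_diff_power_eq)
  moreover have "cis t ^ k = cis (real k * t)" for k by (simp add: Complex.DeMoivre)
  ultimately have "cmod (1 - cis t) * cmod (\<Sum>k<n. cis (real k * t)) = cmod (1 - cis (real n * t))"
    by (metis (no_types, lifting) norm_mult sum.cong)
  also have "\<dots> \<le> 2" using norm_triangle_ineq4[of 1 "cis (real n * t)"] by simp
  finally have "(cmod (1 - cis t) * cmod (\<Sum>k<n. cis (real k * t)))\<^sup>2 \<le> 2\<^sup>2"
    by (intro power_mono) auto
  moreover have "(cmod (1 - cis t))\<^sup>2 = 4 * (sin (t / 2))\<^sup>2"
  proof -
    have "(cmod (1 - cis t))\<^sup>2 = (1 - cos t)\<^sup>2 + (sin t)\<^sup>2" by (simp add: cmod_power2)
    also have "\<dots> = 2 - 2 * cos t" using sin_cos_squared_add[of t]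
      by (simp add: power2_eq_square algebra_simps)
    also have "\<dots> = 4 * (sin (t / 2))\<^sup>2" using cos_double_sin[of "t / 2"] by simp
    finally show ?thesis .
  qed
  ultimately show ?thesis by (simp add: fejer_def power_mult_distrib mult.commute)
qed

lemma fejer_cosine_polynomial: "n \<ge> 1 \<Longrightarrow> fejer n \<in> cosine_polynomials (n - 1)"
proof -
  assume n: "n \<ge> 1"
  have "(\<lambda>t. \<Sum>i\<in>{..<n} \<times> {..<n}. 1 * cos (real (nat \<bar>int (fst i) - int (snd i)\<bar>) * t))
      \<in> cosine_polynomials (n - 1)"
    by (rule cosine_polynomials_family) (use n in auto)
  moreover have cos_abs: "cos (real (nat \<bar>i\<bar>) * t) = cos (of_int i * t)" for i :: int and t
    using cos_minus[of "of_int i * t"] by (cases "i \<ge> 0") auto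
  ultimately have "(\<lambda>t. \<Sum>i\<in>{..<n} \<times> {..<n}. cos (of_int (int (fst i) - int (snd i)) * t))
      \<in> cosine_polynomials (n - 1)" by (simp only: cos_abs mult_1)
  moreover have "fejer n = (\<lambda>t. \<Sum>i\<in>{..<n} \<times> {..<n}. cos (of_int (int (fst i) - int (snd i)) * t))"
    by (rule ext) (simp add: fejer_double_sum sum.cartesian_product case_prod_unfold)
  ultimately show ?thesis by simp
qed

lemma sum_fejer_equidistant:
  assumes "n \<le> N"
  shows "(\<Sum>m<N. fejer n (t - 2 * pi * real m / real N)) = real n * real N"
proof -
  have "(\<Sum>m<N. fejer n (t - 2 * pi * real m / real N))
     = (\<Sum>j<n. \<Sum>k<n. \<Sum>m<N. cos (of_int (int j - int k) * (t - 2 * pi * real m / real N)))"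
    unfolding fejer_double_sum by (subst sum.swap, intro sum.cong refl sum.swap)
  also have "\<dots> = (\<Sum>j<n. \<Sum>k<n. if j = k then real N else 0)"
    using assms by (intro sum.cong refl) (subst sum_cos_equidistant, auto)
  finally show ?thesis by simp
qed

text \<open>Both bounds come from \<open>sin (a - b) sin (a + b) = sin\<^sup>2 a - sin\<^sup>2 b\<close>, since each factor on the
left is at most \<open>sin a + sin b\<close>. They say that the decay of a kernel in \<open>sin ((t \<plusminus> \<theta>) / 2)\<close> is at
least as good as decay in \<open>sin (t / 2) - sin (\<theta> / 2)\<close>, so nodes \<open>\<theta>\<close> and \<open>2 \<pi> - \<theta>\<close> need no
separate treatment.\<close>

lemma sin_diff_le_sin_add:
  fixes a b :: real
  assumes "0 \<le> sin a" "0 \<le> sin b"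
  shows "\<bar>sin a - sin b\<bar> \<le> \<bar>sin (a - b)\<bar>" "\<bar>sin a - sin b\<bar> \<le> \<bar>sin (a + b)\<bar>"
proof -
  have id: "sin (a - b) * sin (a + b) = (sin a - sin b) * (sin a + sin b)"
  proof -
    have "sin (a - b) * sin (a + b) = (sin a)\<^sup>2 * (cos b)\<^sup>2 - (cos a)\<^sup>2 * (sin b)\<^sup>2"
      by (simp only: sin_add sin_diff) algebra
    also have "\<dots> = (sin a)\<^sup>2 - (sin b)\<^sup>2"
      by (simp add: cos_squared_eq algebra_simps)
    finally show ?thesis by (simp add: power2_eq_square algebra_simps)
  qed
  have "\<bar>sin a * cos b\<bar> \<le> sin a" "\<bar>cos a * sin b\<bar> \<le> sin b"
    using assms abs_cos_le_one by (auto simp: abs_mult mult_left_le mult_left_le_one_le)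
  then have le: "\<bar>sin (a + b)\<bar> \<le> sin a + sin b" "\<bar>sin (a - b)\<bar> \<le> sin a + sin b"
    by (auto simp: sin_add sin_diff)
  have *: "\<bar>sin a - sin b\<bar> \<le> \<bar>x\<bar>" if "x * y = (sin a - sin b) * (sin a + sin b)" "\<bar>y\<bar> \<le> sin a + sin b" for x y
  proof (cases "sin a + sin b = 0")
    case True
    then show ?thesis using assms by (simp add: add_nonneg_eq_0_iff)
  next
    case False
    then have pos: "0 < sin a + sin b" using assms by linarith
    have "\<bar>sin a - sin b\<bar> * (sin a + sin b) = \<bar>x\<bar> * \<bar>y\<bar>"
      using that(1) assms by (metis abs_mult abs_of_nonneg add_nonneg_nonneg)
    also have "\<dots> \<le> \<bar>x\<bar> * (sin a + sin b)" using that(2) by (intro mult_left_mono) auto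
    finally show ?thesis using pos by simp
  qed
  show "\<bar>sin a - sin b\<bar> \<le> \<bar>sin (a - b)\<bar>" by (rule *[OF id le(1)])
  show "\<bar>sin a - sin b\<bar> \<le> \<bar>sin (a + b)\<bar>" by (rule *[OF _ le(2)]) (use id in \<open>simp add: mult.commute\<close>)
qed

lemma fejer_minus: "fejer n (- t) = fejer n t"
proof -
  have "(\<Sum>j<n. \<Sum>k<n. cos (of_int (int j - int k) * - t)) = (\<Sum>j<n. \<Sum>k<n. cos (of_int (int j - int k) * t))"
    by (intro sum.cong refl) (simp only: mult_minus_right cos_minus)
  then show ?thesis by (simp only: fejer_double_sum)
qed

text \<open>The variable in which the polynomials are localized is \<open>x = sqrt ((1 - u) / 2)\<close>, not \<open>u\<close> itself:
with \<open>u = cos t\<close> it is \<open>sin (t / 2)\<close>, and near the endpoint \<open>u = 1\<close> it is, up to a factor, the square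
root of the distance to that endpoint. The decay is stated as a bound on the weighted sum because such bounds
multiply under tensor products and survive regrouping. The last clause controls the growth beyond
\<open>[-1, 1]\<close>.\<close>

definition localized_partition ::
  "real \<Rightarrow> real \<Rightarrow> nat \<Rightarrow> nat \<Rightarrow> (nat \<Rightarrow> real poly) \<Rightarrow> (nat \<Rightarrow> real) \<Rightarrow> bool" where
  "localized_partition l C n N T v \<longleftrightarrow>
     (\<forall>m<N. degree (T m) \<le> N) \<and>
     (\<forall>u. (\<Sum>m<N. poly (T m) u) = 1) \<and>
     (\<forall>m<N. 0 \<le> v m \<and> v m \<le> 1) \<and>
     (\<forall>x\<in>{0..1}. \<forall>m<N. 0 \<le> poly (T m) (1 - 2 * x\<^sup>2)) \<and>
     (\<forall>x\<in>{0..1}. (\<Sum>m<N. poly (T m) (1 - 2 * x\<^sup>2) * (1 + real n * \<bar>x - v m\<bar>) powr l) \<le> C) \<and>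
     (\<forall>u. \<forall>m<N. \<bar>u\<bar> \<le> 3 \<longrightarrow> \<bar>poly (T m) u\<bar> \<le> 7 ^ N)"

text \<open>Take \<open>J = fejer n ^ r\<close>, of degree less than \<open>N = r n\<close>, and let \<open>T m (cos t)\<close> be the average of
\<open>J (t - \<theta>\<^sub>m)\<close> and \<open>J (t + \<theta>\<^sub>m)\<close> divided by the constant sum \<open>A\<close> of all translates of \<open>J\<close>.
The normalization is cheap: \<open>A \<ge> J 0 = n ^ (2 r)\<close>, because at \<open>t = 0\<close> one of the translates,
all of which are nonnegative, has the value \<open>J 0\<close>. In the weighted sum, \<open>r - 1\<close> of the factors \<open>fejer n\<close> absorb the
weight, and the remaining one is summed exactly.\<close>

lemma localized_partition_exists:
  fixes l :: real
  assumes "0 \<le> l"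
  shows "\<exists>K C. 1 \<le> K \<and> 0 < C \<and> (\<forall>n\<ge>1. \<exists>T v. localized_partition l C n (K * n) T v)"
proof -
  define r where "r = Suc (nat \<lceil>l\<rceil>)"
  have l_le: "l \<le> real (2 * (r - 1))" using assms unfolding r_def by simp linarith
  define C :: real where "C = 4 ^ (r - 1) * real r"
  have "\<exists>T v. localized_partition l C n (r * n) T v" if n: "n \<ge> 1" for n
  proof -
    define N where "N = r * n"
    define J where "J = (\<lambda>t. fejer n t ^ r)"
    define k where "k = r * (n - 1)"
    define \<theta> where "\<theta> = (\<lambda>m::nat. 2 * pi * real m / real N)"
    have kN: "k < N" using n unfolding k_def N_def by (intro mult_less_mono2) (auto simp: r_def)
    have nN: "n \<le> N" by (simp add: N_def r_def)
    have N: "0 < N" using kN by simp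
    obtain a where a: "\<And>i. 0 \<le> a i" "\<And>t. J t = (\<Sum>i\<le>k. a i * cos (real i * t))"
      using cosine_polynomials_power[OF fejer_cosine_polynomial[OF n], of r]
      unfolding J_def k_def cosine_polynomials_def by blast
    define A where "A = real N * a 0"
    have sum_cos: "(\<Sum>m<N. cos (real i * (t - \<theta> m))) = (if i = 0 then real N else 0)" if "i \<le> k" for i t
      using sum_cos_equidistant[of "int i" N t] that kN by (simp add: \<theta>_def)
    have sum_a: "(\<Sum>i\<le>k. a i * c i * (\<Sum>m<N. cos (real i * (t - \<theta> m)))) = A * c 0" for c t
    proof -
      have "(\<Sum>i\<le>k. a i * c i * (\<Sum>m<N. cos (real i * (t - \<theta> m))))
          = (\<Sum>i\<le>k. if i = 0 then A * c i else 0)"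
        by (intro sum.cong refl) (auto simp: sum_cos A_def)
      then show ?thesis by simp
    qed
    have sumJ: "(\<Sum>m<N. J (t - \<theta> m)) = A" for t
      using sum_a[of "\<lambda>_. 1" t] unfolding a(2) by (subst sum.swap) (simp add: sum_distrib_left)
    have J_nonneg: "0 \<le> J t" for t by (simp add: J_def fejer_nonneg)
    have J0: "J 0 = real n ^ (2 * r)" by (simp add: J_def fejer_0 power_mult)
    have J0_le: "J 0 \<le> A"
      using member_le_sum[of 0 "{..<N}" "\<lambda>m. J (0 - \<theta> m)"] N J_nonneg sumJ[of 0]
      by (simp add: \<theta>_def)
    have A: "0 < A" 
    proof -
      have "0 < J 0" using J0 n by simp
      then show ?thesis using J0_le by linarith
    qed
    define T where "T = (\<lambda>m. smult (1 / A) (\<Sum>i\<le>k. smult (a i * cos (real i * \<theta> m)) (chebyshev i)))"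
    define v where "v = (\<lambda>m. sin (\<theta> m / 2))"
    have poly_T: "poly (T m) u = (\<Sum>i\<le>k. a i * poly (chebyshev i) u * cos (real i * \<theta> m)) / A" for m u
      by (simp add: T_def poly_sum mult.assoc) (simp add: mult.commute)
    have poly_T_cos: "poly (T m) (cos t) = (J (t - \<theta> m) + J (t + \<theta> m)) / (2 * A)" for m t
    proof -
      have "2 * (a i * cos (real i * t) * cos (real i * \<theta> m))
          = a i * cos (real i * (t - \<theta> m)) + a i * cos (real i * (t + \<theta> m))" for i
        by (simp add: ring_distribs cos_add cos_diff)
      then have "2 * (\<Sum>i\<le>k. a i * cos (real i * t) * cos (real i * \<theta> m)) = J (t - \<theta> m) + J (t + \<theta> m)"
        unfolding a(2) by (simp add: sum_distrib_left sum.distrib)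
      then show ?thesis unfolding poly_T poly_chebyshev_cos using A by (simp add: field_simps)
    qed
    have "degree (T m) \<le> N" for m
    proof -
      have "degree (\<Sum>i\<le>k. smult (a i * cos (real i * \<theta> m)) (chebyshev i)) \<le> N"
        using kN by (intro degree_sum_le order_trans[OF degree_smult_le] order_trans[OF degree_chebyshev]) auto
      then show ?thesis unfolding T_def by (rule order_trans[OF degree_smult_le])
    qed
    moreover have "(\<Sum>m<N. poly (T m) u) = 1" for u
    proof -
      have "(\<Sum>m<N. poly (T m) u) = (\<Sum>m<N. \<Sum>i\<le>k. a i * poly (chebyshev i) u * cos (real i * (0 - \<theta> m))) / A"
        by (simp add: poly_T sum_divide_distrib)
      also have "\<dots> = (\<Sum>i\<le>k. a i * poly (chebyshev i) u * (\<Sum>m<N. cos (real i * (0 - \<theta> m)))) / A"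
        by (subst sum.swap) (simp add: sum_distrib_left)
      also have "\<dots> = 1" unfolding sum_a using A by simp
      finally show ?thesis .
    qed
    moreover have v: "0 \<le> v m \<and> v m \<le> 1" if "m < N" for m
      using that N unfolding v_def \<theta>_def by (auto intro!: sin_ge_zero simp: field_simps)
    moreover have T_nonneg: "0 \<le> poly (T m) (1 - 2 * x\<^sup>2)"
      and "(\<Sum>m<N. poly (T m) (1 - 2 * x\<^sup>2) * (1 + real n * \<bar>x - v m\<bar>) powr l) \<le> C"
      if x: "x \<in> {0..1}" for x m
    proof -
      define t where "t = 2 * arcsin x"
      have sin_t: "sin (t / 2) = x" using x by (simp add: t_def)
      have cos_t: "cos t = 1 - 2 * x\<^sup>2" using cos_double_sin[of "t / 2"] sin_t by simp
      show "0 \<le> poly (T m) (1 - 2 * x\<^sup>2)"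
        using A J_nonneg by (simp add: poly_T_cos flip: cos_t)
      define w where "w = (\<lambda>m. 1 + real n * \<bar>x - v m\<bar>)"
      have w1: "1 \<le> w m" for m by (simp add: w_def)
      \<comment> \<open>Since \<open>w\<^sup>2 fejer \<le> 4 n\<^sup>2\<close>, the weight costs \<open>r - 1\<close> kernel factors.\<close>
      have bound: "J s * w m powr l \<le> (4 * (real n)\<^sup>2) ^ (r - 1) * fejer n s"
        if "\<bar>x - v m\<bar> \<le> \<bar>sin (s / 2)\<bar>" for s m
      proof -
        define \<Delta> where "\<Delta> = \<bar>x - v m\<bar>"
        have "\<Delta>\<^sup>2 \<le> (sin (s / 2))\<^sup>2" using that by (simp add: \<Delta>_def abs_le_square_iff)
        then have F\<Delta>: "fejer n s * \<Delta>\<^sup>2 \<le> 1"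
          using fejer_sin_le[of n s] mult_left_mono[OF _ fejer_nonneg[of n s]] by fastforce
        have "(w m)\<^sup>2 * fejer n s \<le> 4 * (real n)\<^sup>2"
        proof (cases "real n * \<Delta> \<le> 1")
          case True
          then have "(w m)\<^sup>2 \<le> 2\<^sup>2" using w1[of m] by (intro power_mono) (auto simp: w_def \<Delta>_def)
          then have "(w m)\<^sup>2 * fejer n s \<le> 2\<^sup>2 * (real n)\<^sup>2"
            by (rule mult_mono) (simp_all add: fejer_le fejer_nonneg)
          then show ?thesis by simp
        next
          case False
          then have "(w m)\<^sup>2 \<le> (2 * (real n * \<Delta>))\<^sup>2"
            using w1[of m] by (intro power_mono) (auto simp: w_def \<Delta>_def)
          then have "(w m)\<^sup>2 * fejer n s \<le> (2 * (real n * \<Delta>))\<^sup>2 * fejer n s"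
            by (intro mult_right_mono fejer_nonneg)
          also have "\<dots> = 4 * (real n)\<^sup>2 * (fejer n s * \<Delta>\<^sup>2)" by (simp add: power_mult_distrib)
          also have "\<dots> \<le> 4 * (real n)\<^sup>2 * 1" using F\<Delta> by (intro mult_left_mono) auto
          finally show ?thesis by simp
        qed
        then have *: "((w m)\<^sup>2 * fejer n s) ^ (r - 1) \<le> (4 * (real n)\<^sup>2) ^ (r - 1)"
          using fejer_nonneg by (intro power_mono) auto
        have "w m powr l \<le> w m powr real (2 * (r - 1))" using l_le w1[of m] by (intro powr_mono) auto
        also have "\<dots> = (w m)\<^sup>2 ^ (r - 1)" using w1[of m] by (subst powr_realpow) (auto simp: power_mult)
        finally have "J s * w m powr l \<le> J s * (w m)\<^sup>2 ^ (r - 1)" by (intro mult_left_mono J_nonneg)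
        also have "\<dots> = ((w m)\<^sup>2 * fejer n s) ^ (r - 1) * fejer n s"
          by (simp add: J_def r_def power_mult_distrib)
        also have "\<dots> \<le> (4 * (real n)\<^sup>2) ^ (r - 1) * fejer n s"
          using * by (intro mult_right_mono fejer_nonneg)
        finally show ?thesis .
      qed
      have term_le: "poly (T m) (1 - 2 * x\<^sup>2) * w m powr l
          \<le> (4 * (real n)\<^sup>2) ^ (r - 1) / (2 * A) * (fejer n (t - \<theta> m) + fejer n (- t - \<theta> m))" if m: "m < N" for m
      proof -
        have sins: "0 \<le> sin (t / 2)" "0 \<le> sin (\<theta> m / 2)" using x sin_t v[OF m] by (auto simp: v_def)
        have 1: "\<bar>x - v m\<bar> \<le> \<bar>sin ((t - \<theta> m) / 2)\<bar>" "\<bar>x - v m\<bar> \<le> \<bar>sin ((t + \<theta> m) / 2)\<bar>"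
          using sin_diff_le_sin_add[OF sins] by (simp_all add: sin_t v_def diff_divide_distrib add_divide_distrib)
        have "poly (T m) (1 - 2 * x\<^sup>2) * w m powr l
            = (J (t - \<theta> m) * w m powr l + J (t + \<theta> m) * w m powr l) / (2 * A)"
          by (simp add: poly_T_cos field_simps flip: cos_t)
        also have "\<dots> \<le> ((4 * (real n)\<^sup>2) ^ (r - 1) * fejer n (t - \<theta> m)
            + (4 * (real n)\<^sup>2) ^ (r - 1) * fejer n (t + \<theta> m)) / (2 * A)"
          using A by (intro divide_right_mono add_mono bound 1) auto
        also have "fejer n (t + \<theta> m) = fejer n (- t - \<theta> m)"
          using fejer_minus[of n "t + \<theta> m"] by (simp add: algebra_simps)
        finally show ?thesis by (simp add: field_simps)
      qed
      have "(\<Sum>m<N. poly (T m) (1 - 2 * x\<^sup>2) * w m powr l)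
          \<le> (\<Sum>m<N. (4 * (real n)\<^sup>2) ^ (r - 1) / (2 * A) * (fejer n (t - \<theta> m) + fejer n (- t - \<theta> m)))"
        by (intro sum_mono term_le) auto
      also have "\<dots> = (4 * (real n)\<^sup>2) ^ (r - 1) / (2 * A) * (2 * (real n * real N))"
      proof -
        have "(\<Sum>m<N. fejer n (t - \<theta> m) + fejer n (- t - \<theta> m)) = 2 * (real n * real N)"
          unfolding sum.distrib \<theta>_def sum_fejer_equidistant[OF nN] by simp
        then show ?thesis by (simp only: sum_distrib_left[symmetric])
      qed
      also have "\<dots> = C * (J 0 / A)"
      proof -
        have "J 0 = (real n)\<^sup>2 ^ (r - 1) * (real n)\<^sup>2"
          unfolding J0 by (simp add: r_def power_mult[symmetric] power_add[symmetric] mult.commute)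
        then show ?thesis using A
          by (simp add: C_def N_def power_mult_distrib power2_eq_square[of "real n"])
      qed
      also have "\<dots> \<le> C * 1"
        using J0_le A by (intro mult_left_mono) (auto simp: C_def)
      finally show "(\<Sum>m<N. poly (T m) (1 - 2 * x\<^sup>2) * (1 + real n * \<bar>x - v m\<bar>) powr l) \<le> C"
        by (simp add: w_def)
    qed
    moreover have "\<bar>poly (T m) u\<bar> \<le> 7 ^ N" if u: "\<bar>u\<bar> \<le> 3" for u m
    proof -
      have "\<bar>poly (T m) u\<bar> = \<bar>\<Sum>i\<le>k. a i * poly (chebyshev i) u * cos (real i * \<theta> m)\<bar> / A"
        using A by (simp add: poly_T)
      also have "\<dots> \<le> (\<Sum>i\<le>k. a i * 7 ^ N) / A"
      proof (intro divide_right_mono order_trans[OF sum_abs] sum_mono)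
        fix i assume i: "i \<in> {..k}"
        have "\<bar>poly (chebyshev i) u\<bar> \<le> 7 ^ N"
          using chebyshev_growth[OF u, of i] i kN power_increasing[of i N "7::real"]
          by (auto intro: order_trans)
        then have "\<bar>poly (chebyshev i) u\<bar> * \<bar>cos (real i * \<theta> m)\<bar> \<le> 7 ^ N * 1"
          by (intro mult_mono) auto
        then show "\<bar>a i * poly (chebyshev i) u * cos (real i * \<theta> m)\<bar> \<le> a i * 7 ^ N"
          using a(1) by (simp add: abs_mult mult.assoc mult_left_mono)
      qed (use A in auto)
      also have "\<dots> = J 0 / A * 7 ^ N" by (simp add: a(2) sum_distrib_right)
      also have "\<dots> \<le> 1 * 7 ^ N" using J0_le A by (intro mult_right_mono) auto
      finally show ?thesis by simp
    qed
    ultimately have "localized_partition l C n N T v"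
      unfolding localized_partition_def by blast
    then show ?thesis unfolding N_def by blast
  qed
  then show ?thesis by (intro exI[of _ r] exI[of _ C]) (auto simp: C_def r_def)
qed

section \<open>Polynomial step functions\<close>

text \<open>The probability that a binomial variable with parameters \<open>N\<close> and \<open>u\<close> is at most \<open>c N\<close>. As a
function of \<open>u\<close> it drops from 1 to 0 around \<open>u = c\<close>.\<close>

definition binomial_step :: "nat \<Rightarrow> real \<Rightarrow> real poly" where
  "binomial_step N c = (\<Sum>k\<in>{k. k \<le> N \<and> real k \<le> c * real N}. smult (real (N choose k)) ([:0, 1:] ^ k * [:1, -1:] ^ (N - k)))"

lemma poly_binomial_step:
  "poly (binomial_step N c) u = (\<Sum>k\<in>{k. k \<le> N \<and> real k \<le> c * real N}. real (N choose k) * u ^ k * (1 - u) ^ (N - k))"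
  by (simp add: binomial_step_def poly_sum poly_power mult.assoc)

lemma degree_binomial_step: "degree (binomial_step N c) \<le> N"
  unfolding binomial_step_def
proof (intro degree_sum_le order_trans[OF degree_smult_le])
  fix k assume "k \<in> {k. k \<le> N \<and> real k \<le> c * real N}"
  then show "degree ([:0, 1:] ^ k * [:1, -1:] ^ (N - k) :: real poly) \<le> N"
    using degree_mult_le[of "[:0, 1:] ^ k" "[:1, -1:] ^ (N - k) :: real poly"]
      degree_power_le[of "[:0, 1:] :: real poly" k] degree_power_le[of "[:1, -1:] :: real poly" "N - k"] by simp
qed simp

text \<open>Chernoff's bound: each term is multiplied by \<open>exp (\<tau> (c N - k)) \<ge> 1\<close>, after which the full sum is
a binomial expansion.\<close>

lemma binomial_lower_tail:
  fixes b c :: real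
  assumes "0 < c" "c < b" "b \<le> 1"
  shows "\<exists>q. 0 < q \<and> q < 1 \<and> (\<forall>N u. b \<le> u \<and> u \<le> 1 \<longrightarrow>
    (\<Sum>k\<in>{k. k \<le> N \<and> real k \<le> c * real N}. real (N choose k) * u ^ k * (1 - u) ^ (N - k)) \<le> q ^ N)"
proof -
  \<comment> \<open>For this \<open>\<tau>\<close> the exponent is negative, at most \<open>c \<tau> - b (\<tau> - \<tau>\<^sup>2 / 2) = - b \<tau>\<^sup>2 / 2\<close>.\<close>
  define \<tau> where "\<tau> = 1 - c / b"
  have \<tau>: "0 < \<tau>" "\<tau> < 1" using assms by (auto simp: \<tau>_def field_simps)
  define q where "q = exp (c * \<tau> - b * (1 - exp (- \<tau>)))"
  have "exp (- \<tau>) \<le> 1 - \<tau> + \<tau>\<^sup>2 / 2"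
  proof -
    have "1 + \<tau> + \<tau>\<^sup>2 / 2 \<le> exp \<tau>" using exp_lower_Taylor_quadratic[of \<tau>] \<tau> by simp
    then have "1 \<le> exp \<tau> * (1 - \<tau> + \<tau>\<^sup>2 / 2)"
    proof -
      have "(1 + \<tau> + \<tau>\<^sup>2 / 2) * (1 - \<tau> + \<tau>\<^sup>2 / 2) = 1 + (\<tau>\<^sup>2 / 2)\<^sup>2"
        by (simp add: power2_eq_square field_simps)
      moreover have "(1 + \<tau> + \<tau>\<^sup>2 / 2) * (1 - \<tau> + \<tau>\<^sup>2 / 2) \<le> exp \<tau> * (1 - \<tau> + \<tau>\<^sup>2 / 2)"
        using \<open>1 + \<tau> + \<tau>\<^sup>2 / 2 \<le> exp \<tau>\<close> \<tau> by (intro mult_right_mono) auto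
      ultimately show ?thesis by (smt (verit) zero_le_power2)
    qed
    then show ?thesis by (simp add: exp_minus field_simps)
  qed
  then have "b * (\<tau> - \<tau>\<^sup>2 / 2) \<le> b * (1 - exp (- \<tau>))" using assms by (intro mult_left_mono) auto
  moreover have "c * \<tau> < b * (\<tau> - \<tau>\<^sup>2 / 2)"
  proof -
    have c: "c = b * (1 - \<tau>)" using assms by (simp add: \<tau>_def)
    have "b * (\<tau> - \<tau>\<^sup>2 / 2) - c * \<tau> = b * \<tau>\<^sup>2 / 2"
      unfolding c by (simp add: power2_eq_square field_simps)
    moreover have "b * \<tau>\<^sup>2 / 2 > 0" using assms \<tau> by simp
    ultimately show ?thesis by linarith
  qed
  ultimately have q: "0 < q" "q < 1" by (auto simp: q_def)
  have "(\<Sum>k\<in>{k. k \<le> N \<and> real k \<le> c * real N}. real (N choose k) * u ^ k * (1 - u) ^ (N - k)) \<le> q ^ N"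
    if u: "b \<le> u" "u \<le> 1" for N u
  proof -
    have u0: "0 \<le> u" using u assms by linarith
    have "(\<Sum>k\<in>{k. k \<le> N \<and> real k \<le> c * real N}. real (N choose k) * u ^ k * (1 - u) ^ (N - k))
       \<le> (\<Sum>k\<in>{k. k \<le> N \<and> real k \<le> c * real N}. exp (\<tau> * c) ^ N * (real (N choose k) * (u * exp (- \<tau>)) ^ k * (1 - u) ^ (N - k)))"
    proof (intro sum_mono)
      fix k assume "k \<in> {k. k \<le> N \<and> real k \<le> c * real N}"
      then have "\<tau> * real k \<le> \<tau> * (c * real N)" using \<tau> by (intro mult_left_mono) auto
      then have "1 \<le> exp (\<tau> * c * real N - \<tau> * real k)" by simp
      also have "\<dots> = exp (\<tau> * c) ^ N * exp (- \<tau>) ^ k"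
        by (simp add: exp_of_nat_mult[symmetric] exp_add[symmetric] algebra_simps)
      finally have "(real (N choose k) * u ^ k * (1 - u) ^ (N - k)) * 1
         \<le> (real (N choose k) * u ^ k * (1 - u) ^ (N - k)) * (exp (\<tau> * c) ^ N * exp (- \<tau>) ^ k)"
        using u u0 by (intro mult_left_mono) auto
      then show "real (N choose k) * u ^ k * (1 - u) ^ (N - k)
         \<le> exp (\<tau> * c) ^ N * (real (N choose k) * (u * exp (- \<tau>)) ^ k * (1 - u) ^ (N - k))"
        by (simp add: power_mult_distrib algebra_simps)
    qed
    also have "\<dots> \<le> (\<Sum>k\<le>N. exp (\<tau> * c) ^ N * (real (N choose k) * (u * exp (- \<tau>)) ^ k * (1 - u) ^ (N - k)))"
      using u u0 by (intro sum_mono2) auto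
    also have "\<dots> = exp (\<tau> * c) ^ N * (u * exp (- \<tau>) + (1 - u)) ^ N"
      by (simp add: binomial_ring sum_distrib_left)
    also have "\<dots> = (exp (\<tau> * c) * (u * exp (- \<tau>) + (1 - u))) ^ N" by (simp add: power_mult_distrib)
    also have "\<dots> \<le> q ^ N"
    proof (intro power_mono)
      have "u * exp (- \<tau>) + (1 - u) = 1 + - (u * (1 - exp (- \<tau>)))" by (simp add: algebra_simps)
      also have "\<dots> \<le> exp (- (u * (1 - exp (- \<tau>))))" by (rule exp_ge_add_one_self)
      also have "\<dots> \<le> exp (- (b * (1 - exp (- \<tau>))))"
        using u \<tau> by (auto intro: mult_right_mono)
      finally have "exp (\<tau> * c) * (u * exp (- \<tau>) + (1 - u)) \<le> exp (\<tau> * c) * exp (- (b * (1 - exp (- \<tau>))))"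
        by (intro mult_left_mono) auto
      then show "exp (\<tau> * c) * (u * exp (- \<tau>) + (1 - u)) \<le> q"
        by (simp add: q_def exp_add[symmetric] mult.commute)
    qed (use u u0 in auto)
    finally show ?thesis .
  qed
  then show ?thesis using q by blast
qed

text \<open>A cutoff that is exponentially exact at any prescribed rate \<open>B\<close>, at the price of a larger multiple
\<open>K\<close> of \<open>n\<close> as degree. The exponential rate is what compensates the growth of the local
partitions outside their charts.\<close>

lemma step_polynomial:
  fixes a b B :: real
  assumes "0 \<le> a" "a < b" "b \<le> 1" "1 \<le> B"
  shows "\<exists>K. \<forall>n. \<exists>S :: real poly. degree S \<le> K * n \<and>
    (\<forall>u\<in>{0..1}. 0 \<le> poly S u \<and> poly S u \<le> 1) \<and>
    (\<forall>u\<in>{0..a}. 1 - poly S u \<le> 1 / B ^ n) \<and> (\<forall>u\<in>{b..1}. poly S u \<le> 1 / B ^ n)"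
proof -
  define c where "c = (a + b) / 2"
  have c: "0 < c" "a < c" "c < b" "c < 1" using assms by (auto simp: c_def)
  obtain q1 where q1: "0 < q1" "q1 < 1"
    "\<And>N u. b \<le> u \<Longrightarrow> u \<le> 1 \<Longrightarrow>
       (\<Sum>k\<in>{k. k \<le> N \<and> real k \<le> c * real N}. real (N choose k) * u ^ k * (1 - u) ^ (N - k)) \<le> q1 ^ N"
    using binomial_lower_tail[of c b] c assms by blast
  obtain q2 where q2: "0 < q2" "q2 < 1"
    "\<And>N u. 1 - a \<le> u \<Longrightarrow> u \<le> 1 \<Longrightarrow>
       (\<Sum>k\<in>{k. k \<le> N \<and> real k \<le> (1 - c) * real N}. real (N choose k) * u ^ k * (1 - u) ^ (N - k)) \<le> q2 ^ N"
    using binomial_lower_tail[of "1 - c" "1 - a"] c assms by auto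
  define q where "q = max q1 q2"
  have q: "0 < q" "q < 1" "q1 \<le> q" "q2 \<le> q" using q1 q2 by (auto simp: q_def)
  obtain K where K: "q ^ K < 1 / B" using real_arch_pow_inv[of "1 / B" q] q assms by auto
  have qK: "q ^ (K * n) \<le> 1 / B ^ n" for n
    using power_mono[of "q ^ K" "1 / B" n] K q by (simp add: power_mult power_divide)
  have "degree (binomial_step (K * n) c) \<le> K * n \<and>
    (\<forall>u\<in>{0..1}. 0 \<le> poly (binomial_step (K * n) c) u \<and> poly (binomial_step (K * n) c) u \<le> 1) \<and>
    (\<forall>u\<in>{0..a}. 1 - poly (binomial_step (K * n) c) u \<le> 1 / B ^ n) \<and>
    (\<forall>u\<in>{b..1}. poly (binomial_step (K * n) c) u \<le> 1 / B ^ n)" for n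
  proof (intro conjI ballI degree_binomial_step)
    define N where "N = K * n"
    fix u :: real
    have total: "(\<Sum>k\<le>N. real (N choose k) * u ^ k * (1 - u) ^ (N - k)) = 1"
      using binomial_ring[of u "1 - u" N] by simp
    show "0 \<le> poly (binomial_step (K * n) c) u" if "u \<in> {0..1}"
      unfolding poly_binomial_step using that by (intro sum_nonneg) auto
    show "poly (binomial_step (K * n) c) u \<le> 1" if "u \<in> {0..1}"
    proof -
      have "poly (binomial_step N c) u \<le> (\<Sum>k\<le>N. real (N choose k) * u ^ k * (1 - u) ^ (N - k))"
        unfolding poly_binomial_step using that by (intro sum_mono2) auto
      then show ?thesis by (simp add: total flip: N_def)
    qed
    show "poly (binomial_step (K * n) c) u \<le> 1 / B ^ n" if "u \<in> {b..1}"
    proof -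
      have "poly (binomial_step N c) u \<le> q1 ^ N"
        unfolding poly_binomial_step using that by (intro q1(3)) auto
      also have "\<dots> \<le> q ^ N" using q q1 by (intro power_mono) auto
      finally show ?thesis using qK[of n] by (simp add: N_def)
    qed
    show "1 - poly (binomial_step (K * n) c) u \<le> 1 / B ^ n" if u: "u \<in> {0..a}"
    proof -
      let ?f = "\<lambda>k. real (N choose k) * u ^ k * (1 - u) ^ (N - k)"
      \<comment> \<open>The upper tail for \<open>u\<close> is the lower tail for \<open>1 - u\<close>.\<close>
      have "1 - poly (binomial_step N c) u = (\<Sum>k\<in>{..N} - {k. k \<le> N \<and> real k \<le> c * real N}. ?f k)"
        unfolding poly_binomial_step by (subst sum_diff) (auto simp: total)
      also have "\<dots> = (\<Sum>k\<in>{k. k \<le> N \<and> real (N - k) > c * real N}. ?f (N - k))"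
        by (rule sum.reindex_bij_witness[of _ "\<lambda>k. N - k" "\<lambda>k. N - k"]) auto
      also have "\<dots> \<le> (\<Sum>k\<in>{k. k \<le> N \<and> real k \<le> (1 - c) * real N}. ?f (N - k))"
        using u c assms by (intro sum_mono2) (auto simp: of_nat_diff algebra_simps)
      also have "\<dots> = (\<Sum>k\<in>{k. k \<le> N \<and> real k \<le> (1 - c) * real N}. real (N choose k) * (1 - u) ^ k * (1 - (1 - u)) ^ (N - k))"
        by (intro sum.cong) (auto simp: binomial_symmetric[symmetric] mult_ac)
      also have "\<dots> \<le> q2 ^ N" using u by (intro q2(3)) auto
      also have "\<dots> \<le> q ^ N" using q q2 by (intro power_mono) auto
      finally show ?thesis using qK[of n] by (simp add: N_def)
    qed
  qed
  then show ?thesis by blast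
qed

section \<open>Gluing local partitions and separating the sites\<close>

lemma maximal_separated_subset:
  assumes "finite X" "\<And>x. x \<in> X \<Longrightarrow> d x x = 0" "\<And>x y. d x y = d y x" "0 < \<epsilon>"
  obtains \<Lambda> where "\<Lambda> \<subseteq> X" "separated_wrt d \<epsilon> \<Lambda>" "\<And>x. x \<in> X \<Longrightarrow> \<exists>y\<in>\<Lambda>. d x y < (\<epsilon>::real)"
proof -
  have "finite {\<Lambda>. \<Lambda> \<subseteq> X \<and> separated_wrt d \<epsilon> \<Lambda>}" using assms(1) by simp
  moreover have "{} \<in> {\<Lambda>. \<Lambda> \<subseteq> X \<and> separated_wrt d \<epsilon> \<Lambda>}" by (simp add: separated_wrt_def)
  ultimately have "\<exists>\<Lambda>\<in>{\<Lambda>. \<Lambda> \<subseteq> X \<and> separated_wrt d \<epsilon> \<Lambda>}.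
      \<forall>\<Lambda>'\<in>{\<Lambda>. \<Lambda> \<subseteq> X \<and> separated_wrt d \<epsilon> \<Lambda>}. \<Lambda> \<subseteq> \<Lambda>' \<longrightarrow> \<Lambda> = \<Lambda>'"
    by (intro finite_has_maximal) auto
  then obtain \<Lambda> where \<Lambda>: "\<Lambda> \<subseteq> X" "separated_wrt d \<epsilon> \<Lambda>"
    and max: "\<And>\<Lambda>'. \<Lambda>' \<subseteq> X \<Longrightarrow> separated_wrt d \<epsilon> \<Lambda>' \<Longrightarrow> \<Lambda> \<subseteq> \<Lambda>' \<Longrightarrow> \<Lambda> = \<Lambda>'"
    by auto
  have "\<exists>y\<in>\<Lambda>. d x y < \<epsilon>" if "x \<in> X" for x
  proof (rule ccontr)
    assume far: "\<not> (\<exists>y\<in>\<Lambda>. d x y < \<epsilon>)"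
    then have "separated_wrt d \<epsilon> (insert x \<Lambda>)"
      using \<Lambda>(2) assms(3) unfolding separated_wrt_def by (metis insert_iff not_less)
    then have "x \<in> \<Lambda>" using max[of "insert x \<Lambda>"] \<Lambda>(1) that by auto
    then show False using far assms(2)[OF that] assms(4) by auto
  qed
  then show ?thesis using that \<Lambda> by blast
qed

lemma rho_nonneg: "0 \<le> rho \<Omega> x y" by (simp add: rho_def)

lemma rho_self: "rho \<Omega> x x = 0" by (simp add: rho_def)

lemma rho_commute: "rho \<Omega> x y = rho \<Omega> y x"
  by (simp add: rho_def norm_minus_commute abs_minus_commute)

lemma rho_triangle: "rho \<Omega> x z \<le> rho \<Omega> x y + rho \<Omega> y z"
  using norm_triangle_ineq[of "x - y" "y - z"] by (simp add: rho_def)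

text \<open>The requirement that every \<open>P i\<close> decays away from its site \<open>a i\<close>, in summed form. The sum over
all \<open>i\<close> allows polynomials to be grouped without counting how many sites are close together.\<close>

definition decay_sum ::
  "'a::euclidean_space set \<Rightarrow> real \<Rightarrow> nat \<Rightarrow> 'i set \<Rightarrow> ('i \<Rightarrow> 'a \<Rightarrow> real) \<Rightarrow> ('i \<Rightarrow> 'a) \<Rightarrow> 'a \<Rightarrow> real" where
  "decay_sum \<Omega> l n I P a x = (\<Sum>i\<in>I. \<bar>P i x\<bar> * (1 + real n * rho \<Omega> x (a i)) powr l)"

text \<open>A partition of unity that is good only on \<open>V\<close>: on the rest of \<open>\<Omega>\<close> it may grow exponentially in
\<open>n\<close>. The single constant \<open>C\<close> serves for the degree, the decay and the growth.\<close>

definition local_partition ::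
  "'a::euclidean_space set \<Rightarrow> real \<Rightarrow> 'a set \<Rightarrow> real \<Rightarrow> nat \<Rightarrow> 'i set \<Rightarrow> ('i \<Rightarrow> 'a \<Rightarrow> real) \<Rightarrow> ('i \<Rightarrow> 'a) \<Rightarrow> bool" where
  "local_partition \<Omega> l V C n I P a \<longleftrightarrow>
     finite I \<and> a ` I \<subseteq> \<Omega> \<and> (\<forall>i\<in>I. polynomial_degree_le (C * real n) (P i)) \<and>
     (\<forall>x. (\<Sum>i\<in>I. P i x) = 1) \<and>
     (\<forall>x\<in>\<Omega> \<inter> V. decay_sum \<Omega> l n I P a x \<le> C) \<and>
     (\<forall>x\<in>\<Omega>. (\<Sum>i\<in>I. \<bar>P i x\<bar>) \<le> C ^ n)"

text \<open>The sites of the given family may be arbitrarily close together. Each polynomial is reassigned to a point within \<open>1 / n\<close> of its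
site in a maximal separated set of sites, which at most doubles \<open>1 + n rho\<close>, and the polynomials
assigned to the same point are added.\<close>

lemma separated_partition:
  fixes \<Omega> :: "'a::euclidean_space set"
  assumes "0 \<le> l" "n \<ge> 1" "0 \<le> C" "finite I" "a ` I \<subseteq> \<Omega>"
    and deg: "\<And>i. i \<in> I \<Longrightarrow> polynomial_degree_le (C * real n) (P i)"
    and sum1: "\<And>x. x \<in> \<Omega> \<Longrightarrow> (\<Sum>i\<in>I. P i x) = 1"
    and dec: "\<And>x. x \<in> \<Omega> \<Longrightarrow> decay_sum \<Omega> l n I P a x \<le> C"
  shows "\<exists>(m::nat) \<xi> Q. inj_on \<xi> {1..m} \<and> \<xi> ` {1..m} \<subseteq> \<Omega> \<and>
       separated_wrt (rho \<Omega>) (1 / real n) (\<xi> ` {1..m}) \<and>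
       (\<forall>j\<in>{1..m}. polynomial_degree_le (C * real n) (Q j)) \<and>
       (\<forall>x\<in>\<Omega>. (\<Sum>j=1..m. Q j x) = 1 \<and>
          (\<forall>j\<in>{1..m}. \<bar>Q j x\<bar> \<le> 2 powr l * C * (1 + real n * rho \<Omega> x (\<xi> j)) powr (- l)))"
proof -
  obtain \<Lambda> where \<Lambda>: "\<Lambda> \<subseteq> a ` I" "separated_wrt (rho \<Omega>) (1 / real n) \<Lambda>"
    "\<And>x. x \<in> a ` I \<Longrightarrow> \<exists>y\<in>\<Lambda>. rho \<Omega> x y < 1 / real n"
    by (rule maximal_separated_subset[of "a ` I" "rho \<Omega>" "1 / real n"])
      (use assms(2,4) rho_commute rho_self in auto)
  have fin: "finite \<Lambda>" using \<Lambda>(1) assms(4) finite_subset by blast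
  obtain near where near: "\<And>i. i \<in> I \<Longrightarrow> near i \<in> \<Lambda> \<and> rho \<Omega> (a i) (near i) < 1 / real n"
    using bchoice[of I "\<lambda>i y. y \<in> \<Lambda> \<and> rho \<Omega> (a i) y < 1 / real n"] \<Lambda>(3) by (metis image_eqI)
  obtain \<xi> where \<xi>: "bij_betw \<xi> {1..card \<Lambda>} \<Lambda>"
    using fin finite_same_card_bij[of "{1..card \<Lambda>}" \<Lambda>] by auto
  define Q where "Q = (\<lambda>j x. \<Sum>i\<in>{i\<in>I. near i = \<xi> j}. P i x)"
  have img: "\<xi> ` {1..card \<Lambda>} = \<Lambda>" using \<xi> by (simp add: bij_betw_def)
  have "(\<Sum>j=1..card \<Lambda>. Q j x) = 1" if "x \<in> \<Omega>" for x
  proof -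
    have "(\<Sum>j=1..card \<Lambda>. Q j x) = (\<Sum>y\<in>\<Lambda>. \<Sum>i\<in>{i\<in>I. near i = y}. P i x)"
      unfolding Q_def using sum.reindex_bij_betw[OF \<xi>, of "\<lambda>y. \<Sum>i\<in>{i\<in>I. near i = y}. P i x"] by simp
    also have "\<dots> = (\<Sum>i\<in>I. P i x)"
      using assms(4) fin near by (intro sum.group) auto
    finally show ?thesis using sum1[OF that] by simp
  qed
  moreover have "\<bar>Q j x\<bar> \<le> 2 powr l * C * (1 + real n * rho \<Omega> x (\<xi> j)) powr (- l)"
    if x: "x \<in> \<Omega>" and j: "j \<in> {1..card \<Lambda>}" for x j
  proof -
    define W where "W = (1 + real n * rho \<Omega> x (\<xi> j)) powr l"
    have pos: "0 < 1 + real n * rho \<Omega> x y" for y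
      using rho_nonneg[of \<Omega> x y] by (simp add: add_pos_nonneg)
    have W: "0 < W" using pos[of "\<xi> j"] by (simp add: W_def)
    have "W \<le> 2 powr l * (1 + real n * rho \<Omega> x (a i)) powr l" if i: "i \<in> I" "near i = \<xi> j" for i
    proof -
      have "rho \<Omega> x (\<xi> j) \<le> rho \<Omega> x (a i) + 1 / real n"
        using rho_triangle[of \<Omega> x "\<xi> j" "a i"] near[OF i(1)] i(2) by simp
      then have "real n * rho \<Omega> x (\<xi> j) \<le> real n * (rho \<Omega> x (a i) + 1 / real n)"
        by (intro mult_left_mono) auto
      also have "\<dots> = real n * rho \<Omega> x (a i) + 1" using assms(2) by (simp add: field_simps)
      finally have "1 + real n * rho \<Omega> x (\<xi> j) \<le> 2 * (1 + real n * rho \<Omega> x (a i))"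
        using rho_nonneg[of \<Omega> x "a i"] by (smt (verit) mult_nonneg_nonneg of_nat_0_le_iff)
      then have "W \<le> (2 * (1 + real n * rho \<Omega> x (a i))) powr l"
        unfolding W_def using pos[of "\<xi> j"] assms(1) by (intro powr_mono2) auto
      also have "\<dots> = 2 powr l * (1 + real n * rho \<Omega> x (a i)) powr l"
        by (rule powr_mult)
      finally show ?thesis .
    qed
    then have "\<bar>P i x\<bar> * W \<le> 2 powr l * (\<bar>P i x\<bar> * (1 + real n * rho \<Omega> x (a i)) powr l)"
      if "i \<in> {i\<in>I. near i = \<xi> j}" for i
      using that mult_left_mono[of W _ "\<bar>P i x\<bar>"] by (fastforce simp: mult_ac)
    then have "(\<Sum>i\<in>{i\<in>I. near i = \<xi> j}. \<bar>P i x\<bar> * W)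
        \<le> (\<Sum>i\<in>{i\<in>I. near i = \<xi> j}. 2 powr l * (\<bar>P i x\<bar> * (1 + real n * rho \<Omega> x (a i)) powr l))"
      by (intro sum_mono) auto
    also have "\<dots> \<le> (\<Sum>i\<in>I. 2 powr l * (\<bar>P i x\<bar> * (1 + real n * rho \<Omega> x (a i)) powr l))"
      using assms(4) by (intro sum_mono2) auto
    also have "\<dots> = 2 powr l * decay_sum \<Omega> l n I P a x"
      by (simp add: decay_sum_def sum_distrib_left)
    also have "\<dots> \<le> 2 powr l * C" using dec[OF x] by (intro mult_left_mono) auto
    finally have "(\<Sum>i\<in>{i\<in>I. near i = \<xi> j}. \<bar>P i x\<bar>) * W \<le> 2 powr l * C"
      by (simp add: sum_distrib_right)
    moreover have "\<bar>Q j x\<bar> * W \<le> (\<Sum>i\<in>{i\<in>I. near i = \<xi> j}. \<bar>P i x\<bar>) * W"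
      unfolding Q_def using W by (intro mult_right_mono sum_abs) auto
    ultimately have "\<bar>Q j x\<bar> * W \<le> 2 powr l * C" by linarith
    then have "\<bar>Q j x\<bar> \<le> 2 powr l * C / W" using W by (simp add: pos_le_divide_eq)
    then show ?thesis by (simp add: W_def powr_minus divide_inverse)
  qed
  moreover have "polynomial_degree_le (C * real n) (Q j)" for j
    unfolding Q_def using assms(3) deg by (intro degree_le_sum) auto
  moreover have "inj_on \<xi> {1..card \<Lambda>}" using \<xi> by (simp add: bij_betw_def)
  moreover have "\<xi> ` {1..card \<Lambda>} \<subseteq> \<Omega>" using img \<Lambda>(1) assms(5) by blast
  ultimately show ?thesis using \<Lambda>(2) img by (intro exI[of _ "card \<Lambda>"] exI[of _ \<xi>] exI[of _ Q]) simp
qed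

lemma rho_bounded:
  assumes "bounded \<Omega>"
  obtains R where "0 < R" "\<And>x y. x \<in> \<Omega> \<Longrightarrow> y \<in> \<Omega> \<Longrightarrow> rho \<Omega> x y \<le> R"
proof (cases "\<Omega> = {}")
  case True
  then show ?thesis using that[of 1] by simp
next
  case False
  then obtain x0 where x0: "x0 \<in> \<Omega>" by blast
  obtain D where D: "0 < D" "\<And>x y. x \<in> \<Omega> \<Longrightarrow> y \<in> \<Omega> \<Longrightarrow> dist x y \<le> D"
  proof -
    obtain e where "\<forall>x\<in>\<Omega>. \<forall>y\<in>\<Omega>. dist x y \<le> e" using assms[unfolded bounded_two_points] by blast
    then show ?thesis by (intro that[of "max e 1"]) (auto simp: max_def intro: order_trans)
  qed
  define R where "R = D + sqrt (D + infdist x0 (frontier \<Omega>))"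
  have s: "sqrt (infdist x (frontier \<Omega>)) \<le> sqrt (D + infdist x0 (frontier \<Omega>))" if "x \<in> \<Omega>" for x
    using infdist_triangle[of x "frontier \<Omega>" x0] D(2)[OF that x0] by simp
  have "rho \<Omega> x y \<le> R" if "x \<in> \<Omega>" "y \<in> \<Omega>" for x y
  proof -
    have s0: "0 \<le> sqrt (infdist z (frontier \<Omega>))" for z by (simp add: infdist_nonneg)
    have "\<bar>sqrt (infdist x (frontier \<Omega>)) - sqrt (infdist y (frontier \<Omega>))\<bar> \<le> sqrt (D + infdist x0 (frontier \<Omega>))"
      using s[OF that(1)] s[OF that(2)] s0[of x] s0[of y] by linarith
    moreover have "norm (x - y) \<le> D" using D(2)[OF that] by (simp add: dist_norm)
    ultimately show ?thesis unfolding rho_def R_def by linarith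
  qed
  moreover have "0 < R" using D(1) infdist_nonneg[of x0] by (simp add: R_def add_pos_nonneg)
  ultimately show ?thesis using that by blast
qed

text \<open>Any power of \<open>n\<close> is absorbed by \<open>2 ^ n\<close>.\<close>

lemma powr_le_power_2:
  fixes l R :: real
  assumes "0 < l" "0 < R"
  shows "\<exists>E>0. \<forall>n::nat. (1 + real n * R) powr l \<le> E * 2 ^ n"
proof -
  \<comment> \<open>Chosen so that \<open>exp (\<epsilon> y) powr l\<close> grows by the factor 2 when \<open>y\<close> grows by \<open>R\<close>.\<close>
  define \<epsilon> where "\<epsilon> = ln 2 / (R * l)"
  have \<epsilon>: "0 < \<epsilon>" using assms by (simp add: \<epsilon>_def)
  have "(1 + real n * R) powr l \<le> exp (l * \<epsilon>) / \<epsilon> powr l * 2 ^ n" for n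
  proof -
    define y where "y = 1 + real n * R"
    have y: "0 < y" using assms by (simp add: y_def add_pos_nonneg)
    have "\<epsilon> * y \<le> exp (\<epsilon> * y)" using exp_ge_add_one_self[of "\<epsilon> * y"] by linarith
    then have "(\<epsilon> * y) powr l \<le> exp (\<epsilon> * y) powr l"
      using assms \<epsilon> y by (intro powr_mono2) auto
    also have "\<dots> = exp (l * \<epsilon> + real n * ln 2)"
    proof -
      have "\<epsilon> * y * l = l * \<epsilon> + real n * (\<epsilon> * (R * l))" by (simp add: y_def algebra_simps)
      also have "\<epsilon> * (R * l) = ln 2" using assms by (simp add: \<epsilon>_def)
      finally show ?thesis by (simp add: powr_def mult.commute)
    qed
    also have "\<dots> = exp (l * \<epsilon>) * 2 ^ n" by (simp add: exp_add exp_of_nat_mult)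
    finally have "y powr l \<le> exp (l * \<epsilon>) / \<epsilon> powr l * 2 ^ n" using \<epsilon> y by (simp add: powr_mult field_simps)
    then show ?thesis by (simp only: y_def)
  qed
  then show ?thesis using \<epsilon> by (intro exI[of _ "exp (l * \<epsilon>) / \<epsilon> powr l"]) auto
qed

lemma local_partition_mono:
  assumes "local_partition \<Omega> l V C n I P a" "C \<le> C'" "0 \<le> C"
  shows "local_partition \<Omega> l V C' n I P a"
proof -
  have le: "C * real n \<le> C' * real n" "C ^ n \<le> C' ^ n"
    using assms by (auto intro: mult_right_mono power_mono)
  show ?thesis unfolding local_partition_def
  proof (intro conjI ballI allI)
    show "polynomial_degree_le (C' * real n) (P i)" if "i \<in> I" for i
      using assms(1) that le(1) degree_le_mono unfolding local_partition_def by blast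
    show "decay_sum \<Omega> l n I P a x \<le> C'" if "x \<in> \<Omega> \<inter> V" for x
      using assms(1,2) that order_trans unfolding local_partition_def by blast
    show "(\<Sum>i\<in>I. \<bar>P i x\<bar>) \<le> C' ^ n" if "x \<in> \<Omega>" for x
      using assms(1) that le(2) order_trans unfolding local_partition_def by blast
  qed (use assms(1) in \<open>auto simp: local_partition_def\<close>)
qed

lemma telescoping_cutoffs:
  fixes s :: "nat \<Rightarrow> real"
  shows "(\<Sum>j<J. s j * (\<Prod>i<j. 1 - s i)) + (\<Prod>i<J. 1 - s i) = 1"
  by (induction J) (simp_all add: algebra_simps)

text \<open>The \<open>j\<close>-th local partition is multiplied by \<open>s j * (\<Prod>i<j. 1 - s i)\<close>, where \<open>s j\<close> is a cutoff in
the squared distance from \<open>p j\<close>, close to 1 on the ball of radius \<open>r j / 4\<close> and to 0 outside the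
ball of radius \<open>r j / 2\<close>. The remainder \<open>\<Prod>i<J. 1 - s i\<close> is exponentially small on all of \<open>\<Omega>\<close> by
the covering assumption and may be assigned to any site. The rate of the cutoffs is twice the
growth constant of the local partitions; the surplus \<open>2 ^ n\<close> absorbs the weights.\<close>

lemma glue_local_partitions:
  fixes \<Omega> :: "'a::euclidean_space set" and p :: "nat \<Rightarrow> 'a" and r :: "nat \<Rightarrow> real"
  assumes l: "0 < l" and bdd: "bounded \<Omega>" and ne: "\<Omega> \<noteq> {}"
    and r: "\<And>j. j < J \<Longrightarrow> 0 < r j" and p: "\<And>j. j < J \<Longrightarrow> p j \<in> \<Omega>"
    and cover: "\<Omega> \<subseteq> (\<Union>j<J. ball (p j) (r j / 4))"
    and loc: "\<And>j. j < J \<Longrightarrow> \<exists>C\<ge>0. \<forall>n\<ge>1. \<exists>(I :: 'i set) P a. local_partition \<Omega> l (ball (p j) (r j / 2)) C n I P a"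
  shows "\<exists>C>0. \<forall>n\<ge>1. \<exists>(I :: (nat \<times> 'i) option set) P a. finite I \<and> a ` I \<subseteq> \<Omega> \<and>
     (\<forall>i\<in>I. polynomial_degree_le (C * real n) (P i)) \<and>
     (\<forall>x. (\<Sum>i\<in>I. P i x) = 1) \<and> (\<forall>x\<in>\<Omega>. decay_sum \<Omega> l n I P a x \<le> C)"
proof -
  obtain x0 where x0: "x0 \<in> \<Omega>" using ne by blast
  obtain R where R: "0 < R" "\<And>x y. x \<in> \<Omega> \<Longrightarrow> y \<in> \<Omega> \<Longrightarrow> rho \<Omega> x y \<le> R"
    using rho_bounded[OF bdd] by blast
  obtain E where E: "0 < E" "\<And>n::nat. (1 + real n * R) powr l \<le> E * 2 ^ n"
    using powr_le_power_2[OF l R(1)] by blast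
  obtain D0 where D0: "\<And>x y. x \<in> \<Omega> \<Longrightarrow> y \<in> \<Omega> \<Longrightarrow> dist x y \<le> D0"
    using bdd[unfolded bounded_two_points] by blast
  \<comment> \<open>Squared distances divided by \<open>D\<^sup>2\<close> lie in \<open>[0, 1]\<close>; the radii are included so that the
    thresholds of the cutoffs do so, too.\<close>
  define D where "D = \<bar>D0\<bar> + 1 + (\<Sum>j<J. r j)"
  have rD: "r j \<le> D" if "j < J" for j
    using member_le_sum[of j "{..<J}" r] that r by (auto simp: D_def less_imp_le)
  have sum_r: "0 \<le> (\<Sum>j<J. r j)" using r by (intro sum_nonneg) (simp add: less_imp_le)
  then have D: "0 < D" by (simp add: D_def)
  have distD: "dist x y \<le> D" if "x \<in> \<Omega>" "y \<in> \<Omega>" for x y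
    using D0[OF that] sum_r by (simp add: D_def)
  obtain Cf where Cf: "\<And>j. j < J \<Longrightarrow> 0 \<le> Cf j \<and> (\<forall>n\<ge>1. \<exists>(I :: 'i set) P a.
      local_partition \<Omega> l (ball (p j) (r j / 2)) (Cf j) n I P a)"
    using loc by metis
  define C0 where "C0 = 1 + (\<Sum>j<J. Cf j)"
  have C0: "1 \<le> C0" using Cf by (auto simp: C0_def intro: sum_nonneg)
  have CfC0: "Cf j \<le> C0" if "j < J" for j
    using member_le_sum[of j "{..<J}" Cf] that Cf by (auto simp: C0_def)
  have loc': "\<exists>(I :: 'i set) P a. local_partition \<Omega> l (ball (p j) (r j / 2)) C0 n I P a"
    if "j < J" "n \<ge> 1" for j n
    using Cf[OF that(1)] CfC0[OF that(1)] that(2) local_partition_mono by blast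
  define B where "B = 2 * C0"
  have B: "1 \<le> B" "2 \<le> B" using C0 by (auto simp: B_def)
  have "\<exists>K. \<forall>n. \<exists>S :: real poly. degree S \<le> K * n \<and>
    (\<forall>u\<in>{0..1}. 0 \<le> poly S u \<and> poly S u \<le> 1) \<and>
    (\<forall>u\<in>{0..(r j / 4)\<^sup>2 / D\<^sup>2}. 1 - poly S u \<le> 1 / B ^ n) \<and> (\<forall>u\<in>{(r j / 2)\<^sup>2 / D\<^sup>2..1}. poly S u \<le> 1 / B ^ n)"
    if "j < J" for j
  proof (rule step_polynomial)
    show "(r j / 4)\<^sup>2 / D\<^sup>2 < (r j / 2)\<^sup>2 / D\<^sup>2"
      using r[OF that] D by (intro divide_strict_right_mono power_strict_mono) auto
    show "(r j / 2)\<^sup>2 / D\<^sup>2 \<le> 1"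
      using r[OF that] D rD[OF that] by (simp add: power_mono flip: power_divide) (simp add: power_le_one)
  qed (use B in auto)
  then obtain Kf where Kf: "\<And>j n. j < J \<Longrightarrow> \<exists>S :: real poly. degree S \<le> Kf j * n \<and>
    (\<forall>u\<in>{0..1}. 0 \<le> poly S u \<and> poly S u \<le> 1) \<and>
    (\<forall>u\<in>{0..(r j / 4)\<^sup>2 / D\<^sup>2}. 1 - poly S u \<le> 1 / B ^ n) \<and> (\<forall>u\<in>{(r j / 2)\<^sup>2 / D\<^sup>2..1}. poly S u \<le> 1 / B ^ n)"
    by metis
  define K where "K = (\<Sum>j<J. Kf j)"
  have KfK: "Kf j \<le> K" if "j < J" for j
    using member_le_sum[of j "{..<J}" Kf] that by (auto simp: K_def)
  define C where "C = 1 + 2 * real (Suc J) * real K + C0 + real J * (C0 + E) + E"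
  have "\<exists>(I :: (nat \<times> 'i) option set) P a. finite I \<and> a ` I \<subseteq> \<Omega> \<and>
     (\<forall>i\<in>I. polynomial_degree_le (C * real n) (P i)) \<and>
     (\<forall>x. (\<Sum>i\<in>I. P i x) = 1) \<and> (\<forall>x\<in>\<Omega>. decay_sum \<Omega> l n I P a x \<le> C)" if n: "n \<ge> 1" for n
  proof -
    obtain I :: "nat \<Rightarrow> 'i set" and P a where
      IPa: "\<And>j. j < J \<Longrightarrow> local_partition \<Omega> l (ball (p j) (r j / 2)) C0 n (I j) (P j) (a j)"
      using loc'[OF _ n] by metis
    obtain S :: "nat \<Rightarrow> real poly" where
      S: "\<And>j. j < J \<Longrightarrow> degree (S j) \<le> Kf j * n \<and>
    (\<forall>u\<in>{0..1}. 0 \<le> poly (S j) u \<and> poly (S j) u \<le> 1) \<and>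
    (\<forall>u\<in>{0..(r j / 4)\<^sup>2 / D\<^sup>2}. 1 - poly (S j) u \<le> 1 / B ^ n) \<and> (\<forall>u\<in>{(r j / 2)\<^sup>2 / D\<^sup>2..1}. poly (S j) u \<le> 1 / B ^ n)"
      using Kf[of _ n] by metis
    define s where "s = (\<lambda>j x. poly (S j) ((norm (x - p j))\<^sup>2 / D\<^sup>2))"
    define q where "q = (\<lambda>j x. s j x * (\<Prod>i<j. 1 - s i x))"
    define I' where "I' = insert None (Some ` (SIGMA j:{..<J}. I j))"
    define P' where "P' = (\<lambda>i x. case i of None \<Rightarrow> (\<Prod>i<J. 1 - s i x) | Some (j, i) \<Rightarrow> q j x * P j i x)"
    define a' where "a' = (\<lambda>i. case i of None \<Rightarrow> x0 | Some (j, i) \<Rightarrow> a j i)"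
    have finI: "finite (I j)" if "j < J" for j using IPa[OF that] by (simp add: local_partition_def)
    have sum_I': "(\<Sum>i\<in>I'. f i) = f None + (\<Sum>j<J. \<Sum>i\<in>I j. f (Some (j, i)))" for f :: "_ \<Rightarrow> real"
    proof -
      have "(\<Sum>i\<in>I'. f i) = f None + (\<Sum>i\<in>Some ` (SIGMA j:{..<J}. I j). f i)"
        unfolding I'_def using finI by (subst sum.insert) auto
      also have "(\<Sum>i\<in>Some ` (SIGMA j:{..<J}. I j). f i) = (\<Sum>i\<in>(SIGMA j:{..<J}. I j). f (Some i))"
        by (subst sum.reindex) auto
      also have "\<dots> = (\<Sum>j<J. \<Sum>i\<in>I j. f (Some (j, i)))"
        using finI by (subst sum.Sigma) (auto simp: case_prod_unfold)
      finally show ?thesis .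
    qed
    have s01: "0 \<le> s j x" "s j x \<le> 1" if "j < J" "x \<in> \<Omega>" for j x
    proof -
      have "norm (x - p j) \<le> D" using distD[OF that(2) p[OF that(1)]] by (simp add: dist_norm)
      then have "(norm (x - p j))\<^sup>2 / D\<^sup>2 \<in> {0..1}" using D by (simp add: power_mono)
      then show "0 \<le> s j x" "s j x \<le> 1" using S[OF that(1)] unfolding s_def by blast+
    qed
    have s_near: "1 - s j x \<le> 1 / B ^ n" if "j < J" "x \<in> ball (p j) (r j / 4)" for j x
    proof -
      have "norm (x - p j) \<le> r j / 4" using that(2) by (simp add: dist_norm norm_minus_commute)
      then have "(norm (x - p j))\<^sup>2 / D\<^sup>2 \<le> (r j / 4)\<^sup>2 / D\<^sup>2" using D by (intro divide_right_mono power_mono) auto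
      then show ?thesis using S[OF that(1)] unfolding s_def by auto
    qed
    have s_far: "s j x \<le> 1 / B ^ n" if "j < J" "x \<in> \<Omega>" "x \<notin> ball (p j) (r j / 2)" for j x
    proof -
      have "norm (x - p j) \<le> D" using distD[OF that(2) p[OF that(1)]] by (simp add: dist_norm)
      then have 1: "(norm (x - p j))\<^sup>2 / D\<^sup>2 \<le> 1" using D by (simp add: power_mono)
      have "r j / 2 \<le> norm (x - p j)" using that(3) by (simp add: dist_norm norm_minus_commute)
      then have "(r j / 2)\<^sup>2 / D\<^sup>2 \<le> (norm (x - p j))\<^sup>2 / D\<^sup>2"
        using r[OF that(1)] D by (intro divide_right_mono power_mono) auto
      then show ?thesis using S[OF that(1)] 1 unfolding s_def by auto
    qed
    have prod01: "0 \<le> (\<Prod>i\<in>A. 1 - s i x)" "(\<Prod>i\<in>A. 1 - s i x) \<le> 1" if "A \<subseteq> {..<J}" "x \<in> \<Omega>" for A x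
      using that s01 by (auto intro!: prod_nonneg prod_le_1 simp: subset_iff)
    have q: "\<bar>q j x\<bar> \<le> s j x" if "j < J" "x \<in> \<Omega>" for j x
    proof -
      have "{..<j} \<subseteq> {..<J}" using that by auto
      then show ?thesis using prod01[of "{..<j}" x] s01[of j x] that
        by (auto simp: q_def abs_mult mult_left_le)
    qed
    have B2: "1 / B ^ n \<le> 1 / 2 ^ n" using B by (intro divide_left_mono power_mono) auto
    have w: "(1 + real n * rho \<Omega> x y) powr l \<le> E * 2 ^ n" if "x \<in> \<Omega>" "y \<in> \<Omega>" for x y
    proof -
      have "(1 + real n * rho \<Omega> x y) powr l \<le> (1 + real n * R) powr l"
        using l R(2)[OF that] rho_nonneg[of \<Omega> x y] by (intro powr_mono2 add_left_mono mult_left_mono) auto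
      then show ?thesis using E(2)[of n] by linarith
    qed
    have piece: "\<bar>q j x\<bar> * decay_sum \<Omega> l n (I j) (P j) (a j) x \<le> C0 + E" if j: "j < J" and x: "x \<in> \<Omega>" for j x
    proof (cases "x \<in> ball (p j) (r j / 2)")
      case True
      have "decay_sum \<Omega> l n (I j) (P j) (a j) x \<le> C0"
        using IPa[OF j] True x by (auto simp: local_partition_def)
      moreover have "0 \<le> decay_sum \<Omega> l n (I j) (P j) (a j) x"
        unfolding decay_sum_def by (intro sum_nonneg) auto
      moreover have "\<bar>q j x\<bar> \<le> 1" using q[OF j x] s01[OF j x] by linarith
      ultimately show ?thesis using E(1) C0 mult_left_le_one_le by (smt (verit))
    next
      case False
      have "decay_sum \<Omega> l n (I j) (P j) (a j) x \<le> (\<Sum>i\<in>I j. \<bar>P j i x\<bar> * (E * 2 ^ n))"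
        unfolding decay_sum_def using IPa[OF j] x
        by (intro sum_mono mult_left_mono w) (auto simp: local_partition_def)
      also have "\<dots> = (\<Sum>i\<in>I j. \<bar>P j i x\<bar>) * (E * 2 ^ n)" by (simp add: sum_distrib_right)
      also have "\<dots> \<le> C0 ^ n * (E * 2 ^ n)"
        using IPa[OF j] x E(1) by (intro mult_right_mono) (auto simp: local_partition_def)
      also have "\<dots> = E * B ^ n" by (simp add: B_def power_mult_distrib)
      finally have d: "decay_sum \<Omega> l n (I j) (P j) (a j) x \<le> E * B ^ n" .
      have "\<bar>q j x\<bar> \<le> 1 / B ^ n" using q[OF j x] s_far[OF j x False] by linarith
      then have "\<bar>q j x\<bar> * decay_sum \<Omega> l n (I j) (P j) (a j) x \<le> 1 / B ^ n * (E * B ^ n)"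
        using d E(1) B by (intro mult_mono') (auto simp: decay_sum_def intro: sum_nonneg)
      then show ?thesis using B C0 by simp
    qed
    have "decay_sum \<Omega> l n I' P' a' x \<le> C" if x: "x \<in> \<Omega>" for x
    proof -
      have "\<bar>\<Prod>i<J. 1 - s i x\<bar> \<le> 1 / 2 ^ n"
      proof -
        obtain j where j: "j < J" "x \<in> ball (p j) (r j / 4)" using cover x by blast
        have "(\<Prod>i<J. 1 - s i x) = (1 - s j x) * (\<Prod>i\<in>{..<J} - {j}. 1 - s i x)"
          using j by (subst prod.remove[of _ j]) auto
        also have "\<dots> \<le> (1 - s j x) * 1"
          using prod01[of "{..<J} - {j}" x] x s01[of j x] j by (intro mult_left_mono) auto
        finally show ?thesis using s_near[OF j] B2 prod01[of "{..<J}" x] x by auto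
      qed
      then have "\<bar>\<Prod>i<J. 1 - s i x\<bar> * (1 + real n * rho \<Omega> x x0) powr l \<le> 1 / 2 ^ n * (E * 2 ^ n)"
        using w[OF x x0] by (intro mult_mono) auto
      then have N: "\<bar>P' None x\<bar> * (1 + real n * rho \<Omega> x (a' None)) powr l \<le> E" by (simp add: P'_def a'_def)
      have "decay_sum \<Omega> l n I' P' a' x = \<bar>P' None x\<bar> * (1 + real n * rho \<Omega> x (a' None)) powr l
          + (\<Sum>j<J. \<bar>q j x\<bar> * decay_sum \<Omega> l n (I j) (P j) (a j) x)"
        unfolding decay_sum_def sum_I' by (simp add: P'_def a'_def abs_mult sum_distrib_left mult.assoc)
      also have "\<dots> \<le> E + (\<Sum>j<J. C0 + E)"
        using N x by (intro add_mono sum_mono piece) auto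
      also have "\<dots> \<le> C" using C0 by (simp add: C_def)
      finally show ?thesis .
    qed
    moreover have "(\<Sum>i\<in>I'. P' i x) = 1" for x
    proof -
      have "(\<Sum>i\<in>I j. P j i x) = 1" if "j < J" for j using IPa[OF that] by (simp add: local_partition_def)
      then have "(\<Sum>i\<in>I'. P' i x) = (\<Prod>i<J. 1 - s i x) + (\<Sum>j<J. q j x)"
        unfolding sum_I' by (simp add: P'_def flip: sum_distrib_left)
      then show ?thesis using telescoping_cutoffs[of "\<lambda>j. s j x" J] by (simp add: q_def)
    qed
    moreover have "polynomial_degree_le (C * real n) (P' i)" if i: "i \<in> I'" for i
    proof -
      define k where "k = real (K * n) * 2"
      have s_deg: "polynomial_degree_le k (s j)" if "j < J" for j
      proof -
        have "polynomial_degree_le 2 (\<lambda>x. x \<bullet> x - 2 * (x \<bullet> p j) + p j \<bullet> p j)"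
        proof (intro degree_le_add degree_le_diff degree_le_cmult degree_le_const degree_le_inner)
          have "polynomial_degree_le 2 (\<lambda>x::'a. \<Sum>b\<in>Basis. (x \<bullet> b) * (x \<bullet> b))"
            using degree_le_mult[OF degree_le_inner_Basis[of 1] degree_le_inner_Basis[of 1]] by (intro degree_le_sum) auto
          then show "polynomial_degree_le 2 (\<lambda>x::'a. x \<bullet> x)" by (simp add: euclidean_inner[symmetric])
        qed auto
        then have "polynomial_degree_le 2 (\<lambda>x. (1 / D\<^sup>2) * (x \<bullet> x - 2 * (x \<bullet> p j) + p j \<bullet> p j))" by (rule degree_le_cmult)
        moreover have "(norm (x - p j))\<^sup>2 / D\<^sup>2 = (1 / D\<^sup>2) * (x \<bullet> x - 2 * (x \<bullet> p j) + p j \<bullet> p j)" for x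
          by (simp add: power2_norm_eq_inner inner_diff inner_commute algebra_simps flip: add_divide_distrib)
        ultimately have "polynomial_degree_le 2 (\<lambda>x. (norm (x - p j))\<^sup>2 / D\<^sup>2)" by (simp only:)
        moreover have "degree (S j) \<le> K * n" using S[OF that] KfK[OF that] by (meson mult_le_mono1 order_trans)
        ultimately show ?thesis unfolding s_def k_def by (rule degree_le_poly) auto
      qed
      have k: "0 \<le> k" by (simp add: k_def)
      have prod_deg: "polynomial_degree_le (real j * k) (\<lambda>x. \<Prod>i<j. 1 - s i x)" if "j \<le> J" for j
      proof -
        have "polynomial_degree_le k (\<lambda>x. 1 - s i x)" if "i < j" for i
          using that \<open>j \<le> J\<close> by (intro degree_le_diff degree_le_const k s_deg) auto
        then show ?thesis using degree_le_prod[of "{..<j}" k "\<lambda>i x. 1 - s i x"] by simp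
      qed
      have kC: "real (Suc J) * k + C0 * real n \<le> C * real n"
      proof -
        have "real (Suc J) * k + C0 * real n = (2 * real (Suc J) * real K + C0) * real n"
          by (simp add: k_def algebra_simps)
        also have "\<dots> \<le> C * real n" using C0 E(1) by (intro mult_right_mono) (auto simp: C_def)
        finally show ?thesis .
      qed
      show ?thesis
      proof (cases i)
        case None
        have "polynomial_degree_le (C * real n) (\<lambda>x. \<Prod>i<J. 1 - s i x)"
        proof (rule degree_le_mono[OF prod_deg[OF order_refl]])
          have "0 \<le> C0 * real n" using C0 by simp
          then show "real J * k \<le> C * real n" using kC k by (simp add: algebra_simps)
        qed
        then show ?thesis using None by (simp add: P'_def)
      next
        case (Some ji)
        then obtain j i' where ji: "i = Some (j, i')" "j < J" "i' \<in> I j" using i by (auto simp: I'_def)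
        have "polynomial_degree_le (k + real j * k + C0 * real n) (\<lambda>x. s j x * (\<Prod>i<j. 1 - s i x) * P j i' x)"
          using ji IPa[OF ji(2)] by (intro degree_le_mult s_deg prod_deg) (auto simp: local_partition_def)
        moreover have "k + real j * k + C0 * real n \<le> C * real n"
        proof -
          have "real j * k \<le> real J * k" using ji k by (intro mult_right_mono) auto
          then show ?thesis using kC by (simp add: algebra_simps)
        qed
        ultimately show ?thesis unfolding ji(1) by (auto simp: P'_def q_def intro: degree_le_mono)
      qed
    qed
    moreover have "finite I'" unfolding I'_def using finI by (intro finite.insertI finite_imageI finite_SigmaI) auto
    moreover have "a' ` I' \<subseteq> \<Omega>" using IPa x0 by (auto simp: I'_def a'_def local_partition_def image_subset_iff)
    ultimately show ?thesis by blast
  qed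
  moreover have "0 < C" using C0 E(1) by (simp add: C_def add_pos_nonneg)
  ultimately show ?thesis by blast
qed

section \<open>Functions with Lipschitz gradient\<close>

locale C11_function =
  fixes f :: "real ^ 'd::finite \<Rightarrow> real" and G :: "real ^ 'd \<Rightarrow> real ^ 'd" and M :: real
  assumes f_deriv: "(f has_derivative (\<lambda>h. G y \<bullet> h)) (at y)"
    and G_lipschitz: "norm (G y - G z) \<le> M * norm (y - z)"
    and M_nonneg: "0 \<le> M"
begin

text \<open>The second difference is the change in vertical extent of the segment between two points at fixed depths
below the graph of \<open>f\<close> when both are moved tangentially by \<open>h\<close>.\<close>

lemma increment_lipschitz:
  "\<bar>(f (y + h) - f y) - (f (w + h) - f w)\<bar> \<le> M * norm h * norm (y - w)"
proof -
  have "norm ((\<lambda>u. f (u + h) - f u) y - (\<lambda>u. f (u + h) - f u) w) \<le> (M * norm h) * norm (y - w)"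
  proof (rule differentiable_bound[where S = UNIV and f' = "\<lambda>u k. (G (u + h) - G u) \<bullet> k"])
    fix u
    show "((\<lambda>u. f (u + h) - f u) has_derivative (\<lambda>k. (G (u + h) - G u) \<bullet> k)) (at u within UNIV)"
    proof -
      have "((\<lambda>u. u + h) has_derivative (\<lambda>k. k)) (at u)"
        using has_derivative_add[OF has_derivative_ident has_derivative_const] by simp
      then have "((\<lambda>u. f (u + h)) has_derivative (\<lambda>k. G (u + h) \<bullet> k)) (at u)"
        by (rule has_derivative_compose) (rule f_deriv)
      then have "((\<lambda>u. f (u + h) - f u) has_derivative (\<lambda>k. G (u + h) \<bullet> k - G u \<bullet> k)) (at u)"
        by (intro has_derivative_diff f_deriv)
      then show ?thesis by (simp add: inner_diff_left)
    qed
    have "norm ((G (u + h) - G u) \<bullet> k) \<le> M * norm h * norm k" for k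
      using Cauchy_Schwarz_ineq2[of "G (u + h) - G u" k] G_lipschitz[of "u + h" u]
        mult_right_mono[of "norm (G (u + h) - G u)" "M * norm h" "norm k"] by simp
    then show "onorm (\<lambda>k. (G (u + h) - G u) \<bullet> k) \<le> M * norm h"
      by (rule onorm_le)
  qed auto
  then show ?thesis by simp
qed

lemma taylor: "\<bar>f z - f y - G y \<bullet> (z - y)\<bar> \<le> M * (norm (z - y))\<^sup>2"
proof -
  have "norm ((\<lambda>u. f u - G y \<bullet> u) z - (\<lambda>u. f u - G y \<bullet> u) y) \<le> (M * norm (z - y)) * norm (z - y)"
  proof (rule differentiable_bound[where S = "closed_segment y z" and f' = "\<lambda>u k. (G u - G y) \<bullet> k"])
    fix u assume u: "u \<in> closed_segment y z"
    show "((\<lambda>u. f u - G y \<bullet> u) has_derivative (\<lambda>k. (G u - G y) \<bullet> k)) (at u within closed_segment y z)"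
    proof -
      have "((\<lambda>u. f u - G y \<bullet> u) has_derivative (\<lambda>k. G u \<bullet> k - G y \<bullet> k)) (at u within closed_segment y z)"
        by (intro has_derivative_diff has_derivative_at_withinI[OF f_deriv] has_derivative_inner_right has_derivative_ident)
      then show ?thesis by (simp add: inner_diff_left)
    qed
    have "norm (u - y) \<le> norm (z - y)" using segment_bound(1)[OF u] by (simp add: norm_minus_commute)
    then have "norm (G u - G y) \<le> M * norm (z - y)"
      using G_lipschitz[of u y] M_nonneg mult_left_mono order_trans by blast
    then have "norm ((G u - G y) \<bullet> k) \<le> M * norm (z - y) * norm k" for k
      using Cauchy_Schwarz_ineq2[of "G u - G y" k] mult_right_mono[of "norm (G u - G y)" "M * norm (z - y)" "norm k"] by simp
    then show "onorm (\<lambda>k. (G u - G y) \<bullet> k) \<le> M * norm (z - y)"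
      by (rule onorm_le)
  qed auto
  then show ?thesis by (simp add: inner_diff_right power2_eq_square mult.assoc)
qed

lemma bounds_on_ball:
  "\<exists>B\<ge>1. \<forall>y. norm y \<le> r \<longrightarrow> norm (G y) \<le> B \<and> \<bar>f y\<bar> \<le> B \<and>
     (\<forall>z. norm z \<le> r \<longrightarrow> \<bar>f y - f z\<bar> \<le> B * norm (y - z))"
proof -
  define B1 where "B1 = norm (G 0) + M * \<bar>r\<bar>"
  have B1: "0 \<le> B1" using M_nonneg by (simp add: B1_def)
  have G: "norm (G y) \<le> B1" if "norm y \<le> r" for y
  proof -
    have "norm (G y - G 0) \<le> M * \<bar>r\<bar>"
    proof -
      have "M * norm y \<le> M * \<bar>r\<bar>" using that M_nonneg by (intro mult_left_mono) auto
      then show ?thesis using G_lipschitz[of y 0] by simp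
    qed
    then show ?thesis using norm_triangle_sub[of "G y" "G 0"] by (simp add: B1_def)
  qed
  have L: "\<bar>f y - f z\<bar> \<le> B1 * norm (y - z)" if "norm y \<le> r" "norm z \<le> r" for y z
  proof -
    have "norm (f y - f z) \<le> B1 * norm (y - z)"
    proof (rule differentiable_bound[where S = "cball 0 r" and f' = "\<lambda>u k. G u \<bullet> k"])
      fix u :: "real ^ 'd" assume u: "u \<in> cball 0 r"
      show "(f has_derivative (\<lambda>k. G u \<bullet> k)) (at u within cball 0 r)"
        by (rule has_derivative_at_withinI[OF f_deriv])
      have "norm (G u \<bullet> k) \<le> B1 * norm k" for k
        using Cauchy_Schwarz_ineq2[of "G u" k] G[of u] u mult_right_mono[of "norm (G u)" B1 "norm k"] by simp
      then show "onorm (\<lambda>k. G u \<bullet> k) \<le> B1" by (rule onorm_le)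
    qed (use that in auto)
    then show ?thesis by simp
  qed
  have F: "\<bar>f y\<bar> \<le> \<bar>f 0\<bar> + B1 * \<bar>r\<bar>" if "norm y \<le> r" for y
  proof -
    have "0 \<le> r" using that norm_ge_zero order_trans by blast
    moreover have "B1 * norm y \<le> B1 * \<bar>r\<bar>" using that B1 by (intro mult_left_mono) auto
    ultimately show ?thesis using L[OF that, of 0] by simp
  qed
  define B where "B = 1 + B1 + \<bar>f 0\<bar> + B1 * \<bar>r\<bar>"
  have nn: "0 \<le> B1 * \<bar>r\<bar>" using B1 by simp
  have BB: "B1 \<le> B" using nn by (simp add: B_def)
  show ?thesis
  proof (intro exI[of _ B] conjI allI impI)
    show "1 \<le> B" using nn B1 by (simp add: B_def)
    fix y :: "real ^ 'd" assume y: "norm y \<le> r"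
    show "norm (G y) \<le> B" using G[OF y] BB by linarith
    show "\<bar>f y\<bar> \<le> B" using F[OF y] B1 by (simp add: B_def)
    show "\<bar>f y - f z\<bar> \<le> B * norm (y - z)" if "norm z \<le> r" for z
      using L[OF y that] mult_right_mono[OF BB, of "norm (y - z)"] by simp
  qed
qed

end

text \<open>Bounded second partial derivatives make each first partial derivative globally Lipschitz.\<close>

lemma C11_of_C2:
  fixes f :: "real ^ 'd::finite \<Rightarrow> real"
  assumes "C2_function f" and bd: "\<And>i k x. \<bar>partial_deriv i (partial_deriv k f) x\<bar> \<le> M"
  shows "\<exists>G M'. C11_function f G M'"
proof -
  have repr: "(g has_derivative (\<lambda>h. (\<chi> i. partial_deriv i g y) \<bullet> h)) (at y)"
    if "g differentiable (at y)" for g :: "real ^ 'd \<Rightarrow> real" and y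
  proof -
    have D: "(g has_derivative frechet_derivative g (at y)) (at y)"
      using that frechet_derivative_works by blast
    then have lin: "linear (frechet_derivative g (at y))" by (rule has_derivative_linear)
    have "frechet_derivative g (at y) h = (\<chi> i. partial_deriv i g y) \<bullet> h" for h
    proof -
      have "frechet_derivative g (at y) h = frechet_derivative g (at y) (\<Sum>i\<in>UNIV. (h $ i) *\<^sub>R axis i 1)"
        using basis_expansion[of h] by (simp add: scalar_mult_eq_scaleR)
      also have "\<dots> = (\<Sum>i\<in>UNIV. (h $ i) * frechet_derivative g (at y) (axis i 1))"
        using lin by (simp add: linear_sum linear_scale)
      finally show ?thesis by (simp add: inner_vec_def partial_deriv_def mult.commute)
    qed
    then show ?thesis using D by (metis (no_types, lifting) ext)
  qed
  have M: "0 \<le> M" using bd[of undefined undefined undefined] by linarith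
  define G where "G = (\<lambda>y. \<chi> i. partial_deriv i f y)"
  have C1: "C1_function f" "C1_function (partial_deriv i f)" for i
    using assms(1) by (auto simp: C2_function_def)
  have lip: "norm (partial_deriv k f y - partial_deriv k f z) \<le> (real CARD('d) * M) * norm (y - z)" for k y z
  proof (rule differentiable_bound[where S = UNIV and f' = "\<lambda>u h. (\<chi> i. partial_deriv i (partial_deriv k f) u) \<bullet> h"])
    fix u :: "real ^ 'd"
    show "(partial_deriv k f has_derivative (\<lambda>h. (\<chi> i. partial_deriv i (partial_deriv k f) u) \<bullet> h)) (at u within UNIV)"
      using repr C1(2) by (auto simp: C1_function_def)
    have "norm ((\<chi> i. partial_deriv i (partial_deriv k f) u) \<bullet> h) \<le> real CARD('d) * M * norm h" for h
    proof -
      have "norm ((\<chi> i. partial_deriv i (partial_deriv k f) u) \<bullet> h) \<le> (\<Sum>i\<in>(UNIV :: 'd set). M * norm h)"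
        unfolding inner_vec_def
      proof (intro sum_norm_le)
        fix i :: 'd
        show "norm ((\<chi> i. partial_deriv i (partial_deriv k f) u) $ i \<bullet> h $ i) \<le> M * norm h"
          using bd[of i k u] component_le_norm_cart[of h i] M by (auto simp: abs_mult intro!: mult_mono)
      qed
      then show ?thesis by simp
    qed
    then show "onorm (\<lambda>h. (\<chi> i. partial_deriv i (partial_deriv k f) u) \<bullet> h) \<le> real CARD('d) * M" by (rule onorm_le)
  qed auto
  have "C11_function f G (real CARD('d) * (real CARD('d) * M))"
  proof
    fix y z
    show "(f has_derivative (\<lambda>h. G y \<bullet> h)) (at y)"
      unfolding G_def using repr C1(1) by (auto simp: C1_function_def)
    have "norm (G y - G z) \<le> (\<Sum>i\<in>UNIV. \<bar>(G y - G z) $ i\<bar>)" by (rule norm_le_l1_cart)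
    also have "\<dots> \<le> (\<Sum>i\<in>(UNIV :: 'd set). (real CARD('d) * M) * norm (y - z))"
      using lip by (intro sum_mono) (auto simp: G_def)
    finally show "norm (G y - G z) \<le> real CARD('d) * (real CARD('d) * M) * norm (y - z)" by simp
  qed (use M in auto)
  then show ?thesis by blast
qed

lemma C11_const: "C11_function (\<lambda>_. c) (\<lambda>_. 0) 0"
  by unfold_locales simp_all

section \<open>Charts and the metric near the boundary\<close>

lemma abs_diff_sqrt:
  fixes a b :: real
  assumes "0 \<le> a" "0 \<le> b"
  shows "\<bar>a - b\<bar> = \<bar>sqrt a - sqrt b\<bar> * (sqrt a + sqrt b)"
proof -
  have "a - b = (sqrt a - sqrt b) * (sqrt a + sqrt b)"
    using assms by (simp add: algebra_simps)
  then show ?thesis using assms by (simp add: abs_mult)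
qed

text \<open>In the coordinates \<open>R (x - v)\<close> the set is, inside a ball, the region below the graph of \<open>f\<close>. The
point \<open>p\<close> may lie in the interior of \<open>\<Omega>\<close>, with a constant \<open>f\<close> so large that the graph does not
meet the ball.\<close>

locale subgraph_chart = C11_function f G M
  for f :: "real ^ 'd::finite \<Rightarrow> real" and G M +
  fixes \<Omega> :: "((real ^ 'd) \<times> real) set" and p v :: "(real ^ 'd) \<times> real" and r :: real
    and R :: "(real ^ 'd) \<times> real \<Rightarrow> (real ^ 'd) \<times> real"
  assumes compact_\<Omega>: "compact \<Omega>" and p_in: "p \<in> \<Omega>" and r_pos: "0 < r"
    and R_orth: "orthogonal_transformation R"
    and chart: "\<Omega> \<inter> ball p r = {x \<in> ball p r. snd (R (x - v)) \<le> f (fst (R (x - v)))}"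
begin

definition tang :: "(real ^ 'd) \<times> real \<Rightarrow> real ^ 'd" where "tang x = fst (R (x - v))"
definition height :: "(real ^ 'd) \<times> real \<Rightarrow> real" where "height x = snd (R (x - v))"
definition depth :: "(real ^ 'd) \<times> real \<Rightarrow> real" where "depth x = f (tang x) - height x"
definition point :: "real ^ 'd \<Rightarrow> real \<Rightarrow> (real ^ 'd) \<times> real" where
  "point w s = v + inv R (w, f w - s)"

abbreviation bdist :: "(real ^ 'd) \<times> real \<Rightarrow> real" where "bdist x \<equiv> infdist x (frontier \<Omega>)"

abbreviation chart_dist :: "(real ^ 'd) \<times> real \<Rightarrow> (real ^ 'd) \<times> real \<Rightarrow> real" where
  "chart_dist x x' \<equiv> norm (tang x - tang x') + \<bar>sqrt (depth x) - sqrt (depth x')\<bar>"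

lemma R_inv: "R (inv R z) = z"
  using orthogonal_transformation_surj[OF R_orth] by (simp add: surj_f_inv_f)

lemma R_linear: "linear R" using R_orth by (rule orthogonal_transformation_linear)

lemma R_diff: "R (x - v) - R (x' - v) = R (x - x')"
  using linear_diff[OF R_linear, of "x - v" "x' - v"] by simp

lemma tang_point [simp]: "tang (point w s) = w" and depth_point [simp]: "depth (point w s) = s"
  by (simp_all add: tang_def depth_def height_def point_def R_inv)

lemma norm_R: "norm (R x) = norm x" by (rule orthogonal_transformation_norm[OF R_orth])

lemma coords: "R (x - v) = (tang x, height x)" by (simp add: tang_def height_def)

lemma norm_coords: "norm (x - x') = norm (tang x - tang x', height x - height x')"
  using R_diff[of x x'] norm_R[of "x - x'"] by (simp add: coords)

lemma tang_le: "norm (tang x - tang x') \<le> norm (x - x')"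
  and height_le: "\<bar>height x - height x'\<bar> \<le> norm (x - x')"
  and norm_le_coords: "norm (x - x') \<le> norm (tang x - tang x') + \<bar>height x - height x'\<bar>"
  unfolding norm_coords[of x x'] using norm_fst_le[of "tang x - tang x'" "height x - height x'"]
    norm_snd_le[of "height x - height x'" "tang x - tang x'"]
    norm_Pair_le[of "tang x - tang x'" "height x - height x'"]
  by (simp_all)

lemma depth_nonneg:
  assumes "x \<in> ball p r"
  shows "x \<in> \<Omega> \<longleftrightarrow> 0 \<le> depth x"
proof -
  have "x \<in> \<Omega> \<inter> ball p r \<longleftrightarrow> x \<in> {x \<in> ball p r. snd (R (x - v)) \<le> f (fst (R (x - v)))}"
    by (simp only: chart)
  then show ?thesis using assms by (simp add: depth_def tang_def height_def)
qed

lemma continuous_coords: "continuous_on UNIV tang" "continuous_on UNIV height"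
proof -
  have "bounded_linear R" using R_linear by (simp add: linear_conv_bounded_linear)
  then have "continuous_on UNIV (\<lambda>x. R (x - v))"
    by (rule bounded_linear.continuous_on) (intro continuous_intros)
  then show "continuous_on UNIV tang" "continuous_on UNIV height"
    unfolding tang_def height_def by (rule continuous_on_fst, rule continuous_on_snd)
qed

lemma continuous_depth: "continuous_on UNIV depth"
proof -
  have "continuous_on UNIV f"
    by (intro continuous_at_imp_continuous_on ballI has_derivative_continuous[OF f_deriv])
  then have "continuous_on UNIV (\<lambda>x. f (tang x))"
    by (rule continuous_on_compose2[OF _ continuous_coords(1)]) simp
  then show ?thesis unfolding depth_def by (rule continuous_on_diff) (rule continuous_coords(2))
qed

text \<open>A point of positive depth has a neighbourhood in the subgraph, and points just above one of depth 0
are not in \<open>\<Omega>\<close>.\<close>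

lemma frontier_iff:
  assumes "x \<in> ball p r"
  shows "x \<in> frontier \<Omega> \<longleftrightarrow> depth x = 0"
proof
  have clo: "closed \<Omega>" using compact_\<Omega> by (rule compact_imp_closed)
  assume x: "x \<in> frontier \<Omega>"
  then have "x \<in> \<Omega>" using clo frontier_subset_closed by blast
  then have "0 \<le> depth x" using depth_nonneg assms by blast
  moreover have "\<not> 0 < depth x"
  proof
    assume "0 < depth x"
    have "open ({x. 0 < depth x} \<inter> ball p r)"
      using continuous_depth by (intro open_Int open_Collect_less continuous_on_const open_ball)
    moreover have "{x. 0 < depth x} \<inter> ball p r \<subseteq> \<Omega>" using depth_nonneg by auto
    ultimately have "x \<in> interior \<Omega>" using \<open>0 < depth x\<close> assms by (auto intro: interiorI)
    then show False using x by (simp add: frontier_def)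
  qed
  ultimately show "depth x = 0" by linarith
next
  assume x: "depth x = 0"
  then have x\<Omega>: "x \<in> \<Omega>" using depth_nonneg assms by auto
  have "x \<notin> interior \<Omega>"
  proof
    assume "x \<in> interior \<Omega>"
    then have "x \<in> interior \<Omega> \<inter> ball p r" using assms by simp
    moreover have "open (interior \<Omega> \<inter> ball p r)" by auto
    ultimately obtain e where e: "0 < e" "ball x e \<subseteq> interior \<Omega> \<inter> ball p r"
      using open_contains_ball by metis
    define x' where "x' = point (tang x) (- (e / 2))"
    have "height x' - height x = e / 2"
      using x depth_point[of "tang x" "- (e / 2)"] by (simp add: x'_def depth_def)
    then have "norm (x' - x) < e"
      using norm_le_coords[of x' x] e by (simp add: x'_def)
    then have "x' \<in> interior \<Omega> \<inter> ball p r" using e by (auto simp: dist_norm norm_minus_commute)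
    then have "0 \<le> depth x'" using depth_nonneg[of x'] interior_subset by blast
    then show False using e by (simp add: x'_def)
  qed
  then show "x \<in> frontier \<Omega>" using x\<Omega> closure_subset by (auto simp: frontier_def)
qed

lemma frontier_nonempty: "frontier \<Omega> \<noteq> {}"
proof -
  have "\<Omega> \<noteq> UNIV" using compact_imp_bounded[OF compact_\<Omega>] not_bounded_UNIV by metis
  then show ?thesis using frontier_eq_empty[of \<Omega>] p_in by blast
qed

lemma depth_lipschitz:
  assumes "\<And>y z. norm y \<le> \<rho> \<Longrightarrow> norm z \<le> \<rho> \<Longrightarrow> \<bar>f y - f z\<bar> \<le> B * norm (y - z)" "0 \<le> B"
    and "norm (tang x) \<le> \<rho>" "norm (tang x') \<le> \<rho>"
  shows "\<bar>depth x - depth x'\<bar> \<le> (B + 1) * norm (x - x')"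
    and "norm (x - x') \<le> (B + 1) * norm (tang x - tang x') + \<bar>depth x - depth x'\<bar>"
proof -
  have "\<bar>f (tang x) - f (tang x')\<bar> \<le> B * norm (tang x - tang x')" using assms by blast
  moreover have "B * norm (tang x - tang x') \<le> B * norm (x - x')"
    using assms(2) tang_le by (intro mult_left_mono) auto
  ultimately show "\<bar>depth x - depth x'\<bar> \<le> (B + 1) * norm (x - x')"
    and "norm (x - x') \<le> (B + 1) * norm (tang x - tang x') + \<bar>depth x - depth x'\<bar>"
    using height_le[of x x'] norm_le_coords[of x x'] by (auto simp: depth_def algebra_simps)
qed

lemma coords_bounded: "\<exists>\<rho>>0. \<forall>x\<in>\<Omega>. norm (tang x) \<le> \<rho> \<and> \<bar>height x\<bar> \<le> \<rho>"
proof -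
  obtain b where b: "0 < b" "\<And>x. x \<in> \<Omega> \<Longrightarrow> norm x \<le> b"
    using compact_imp_bounded[OF compact_\<Omega>] bounded_pos by metis
  have "norm (tang x) \<le> b + norm v \<and> \<bar>height x\<bar> \<le> b + norm v" if "x \<in> \<Omega>" for x
  proof -
    have "norm (x - v) \<le> b + norm v" using norm_triangle_ineq4[of x v] b(2)[OF that] by linarith
    then have "norm (tang x, height x) \<le> b + norm v" using norm_R[of "x - v"] by (simp add: coords)
    then show ?thesis
      using norm_fst_le[of "tang x" "height x"] norm_snd_le[of "height x" "tang x"] by simp
  qed
  then show ?thesis using b(1) by (intro exI[of _ "b + norm v"]) (auto simp: add_pos_nonneg)
qed

text \<open>On bounded sets the difference of the depths is at most a multiple of the difference of their square
roots, and \<open>f\<close> is Lipschitz.\<close>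

lemma norm_le_chart_dist:
  "\<exists>C>0. \<forall>x x'. norm (tang x) \<le> \<rho> \<and> norm (tang x') \<le> \<rho> \<and> 0 \<le> depth x \<and> depth x \<le> \<Delta> \<and>
     0 \<le> depth x' \<and> depth x' \<le> \<Delta> \<longrightarrow> norm (x - x') \<le> C * chart_dist x x'"
proof -
  obtain B where B: "1 \<le> B" "\<And>y z. norm y \<le> \<rho> \<Longrightarrow> norm z \<le> \<rho> \<Longrightarrow> \<bar>f y - f z\<bar> \<le> B * norm (y - z)"
    using bounds_on_ball[of \<rho>] by blast
  define C where "C = (B + 1) + 2 * sqrt \<bar>\<Delta>\<bar>"
  have "norm (x - x') \<le> C * chart_dist x x'"
    if x: "norm (tang x) \<le> \<rho>" "norm (tang x') \<le> \<rho>" "0 \<le> depth x" "depth x \<le> \<Delta>" "0 \<le> depth x'" "depth x' \<le> \<Delta>" for x x'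
  proof -
    have "sqrt (depth x) \<le> sqrt \<bar>\<Delta>\<bar>" "sqrt (depth x') \<le> sqrt \<bar>\<Delta>\<bar>" using x by auto
    then have "\<bar>depth x - depth x'\<bar> \<le> \<bar>sqrt (depth x) - sqrt (depth x')\<bar> * (2 * sqrt \<bar>\<Delta>\<bar>)"
      unfolding abs_diff_sqrt[OF x(3,5)] by (intro mult_left_mono) linarith+
    also have "\<dots> \<le> \<bar>sqrt (depth x) - sqrt (depth x')\<bar> * C" using B(1) by (intro mult_left_mono) (auto simp: C_def)
    finally have 1: "\<bar>depth x - depth x'\<bar> \<le> C * \<bar>sqrt (depth x) - sqrt (depth x')\<bar>" by (simp add: mult.commute)
    have "(B + 1) * norm (tang x - tang x') \<le> C * norm (tang x - tang x')"
      by (intro mult_right_mono) (auto simp: C_def)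
    then show ?thesis using 1 depth_lipschitz(2)[OF B(2) _ x(1,2)] B(1) by (simp add: distrib_left)
  qed
  moreover have "0 < C" using B(1) by (simp add: C_def add_pos_nonneg)
  ultimately show ?thesis by blast
qed

lemma depth_bounded: "\<exists>\<Delta>>0. \<forall>x\<in>\<Omega>. depth x \<le> \<Delta>"
proof -
  obtain \<rho> where \<rho>: "\<And>x. x \<in> \<Omega> \<Longrightarrow> norm (tang x) \<le> \<rho> \<and> \<bar>height x\<bar> \<le> \<rho>" "0 < \<rho>" using coords_bounded by blast
  obtain B where B: "1 \<le> B" "\<And>y. norm y \<le> \<rho> \<Longrightarrow> \<bar>f y\<bar> \<le> B"
    using bounds_on_ball[of \<rho>] by blast
  have "depth x \<le> B + \<rho>" if "x \<in> \<Omega>" for x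
    using \<rho>(1)[OF that] B(2)[of "tang x"] unfolding depth_def by linarith
  then show ?thesis using B(1) \<rho>(2) by (intro exI[of _ "B + \<rho>"]) auto
qed

lemma bdist_lipschitz: "bdist x' \<le> bdist x + norm (x - x')"
  using infdist_triangle[of x' "frontier \<Omega>" x] by (simp add: dist_norm norm_minus_commute)

text \<open>Let \<open>z\<close> be a boundary point nearest to \<open>x\<close>. Moving \<open>z\<close> along the graph by the tangential
displacement \<open>k\<close> from \<open>x\<close> to \<open>x'\<close> gives a boundary point \<open>z'\<close> whose distance to \<open>x'\<close> exceeds
the distance \<open>d\<close> of \<open>x\<close> and \<open>z\<close> at most by a second difference of \<open>f\<close>, bounded by \<open>M \<bar>k\<bar> d\<close>, and the
change \<open>\<bar>depth x - depth x'\<bar>\<close>. As \<open>depth x\<close> is at most a multiple of \<open>d\<close>, all errors are absorbed by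
the square of \<open>sqrt d\<close> plus a multiple of the chart distance. A mere Lipschitz bound for the distance to
the boundary would lose a factor \<open>1 / sqrt d\<close> on the tangential displacement.\<close>

lemma sqrt_bdist_near_boundary:
  "\<exists>\<kappa>>0. \<exists>C>0. \<forall>x\<in>\<Omega> \<inter> ball p (3 * r / 4). \<forall>x'\<in>\<Omega> \<inter> ball p (3 * r / 4).
     bdist x < \<kappa> \<and> norm (tang x - tang x') < \<kappa> \<longrightarrow> sqrt (bdist x') \<le> sqrt (bdist x) + C * chart_dist x x'"
proof -
  obtain \<rho> where \<rho>: "\<And>x. x \<in> \<Omega> \<Longrightarrow> norm (tang x) \<le> \<rho> \<and> \<bar>height x\<bar> \<le> \<rho>" "0 < \<rho>" using coords_bounded by blast
  obtain B where B: "1 \<le> B" "\<And>y z. norm y \<le> 3 * \<rho> \<Longrightarrow> norm z \<le> 3 * \<rho> \<Longrightarrow> \<bar>f y - f z\<bar> \<le> B * norm (y - z)"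
    using bounds_on_ball[of "3 * \<rho>"] by blast
  \<comment> \<open>Small enough for \<open>z\<close> and \<open>z'\<close> to stay in the ball of radius \<open>r\<close>.\<close>
  define \<kappa> where "\<kappa> = r / (8 * (B + 1))"
  have \<kappa>: "0 < \<kappa>" "\<kappa> \<le> r / 8" "(B + 1) * \<kappa> = r / 8"
    using r_pos B(1) by (auto simp: \<kappa>_def field_simps)
  define C where "C = 1 + M * sqrt \<kappa> + (B + 1)"
  have C: "0 < C" using B(1) M_nonneg \<kappa>(1) by (auto simp: C_def add_pos_nonneg)
  have "sqrt (bdist x') \<le> sqrt (bdist x) + C * chart_dist x x'"
    if x: "x \<in> \<Omega>" "x \<in> ball p (3 * r / 4)" and x': "x' \<in> \<Omega>" "x' \<in> ball p (3 * r / 4)"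
      and d: "bdist x < \<kappa>" and h: "norm (tang x - tang x') < \<kappa>" for x x'
  proof -
    obtain z where z: "z \<in> frontier \<Omega>" "bdist x = norm (x - z)"
      using infdist_attains_inf[OF frontier_closed frontier_nonempty, of x] by (metis dist_norm)
    define k where "k = tang x' - tang x"
    define z' where "z' = point (tang z + k) 0"
    have in_big: "y \<in> ball p r" if "y \<in> ball p (3 * r / 4)" for y using that r_pos by auto
    have zb: "norm (p - z) < 7 * r / 8"
      using norm_triangle_ineq[of "p - x" "x - z"] x(2) z(2) d \<kappa>(2) by (simp add: dist_norm)
    then have z0: "depth z = 0" using frontier_iff[of z] z(1) r_pos by (simp add: dist_norm)
    have z\<Omega>: "z \<in> \<Omega>" using z(1) compact_imp_closed[OF compact_\<Omega>] frontier_subset_closed by blast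
    have nk: "norm k < \<kappa>" using h by (simp add: k_def norm_minus_commute)
    have tx: "norm (tang x) \<le> 3 * \<rho>" "norm (tang z) \<le> 3 * \<rho>" using \<rho>(1)[OF x(1)] \<rho>(1)[OF z\<Omega>] \<rho>(2) by auto
    have "norm k \<le> 2 * \<rho>"
      using norm_triangle_ineq4[of "tang x'" "tang x"] \<rho>(1)[OF x(1)] \<rho>(1)[OF x'(1)] by (simp add: k_def)
    then have tz': "norm (tang z') \<le> 3 * \<rho>"
      using norm_triangle_ineq[of "tang z" k] \<rho>(1)[OF z\<Omega>] by (simp add: z'_def)
    have "norm (z - z') \<le> (B + 1) * norm k"
      using depth_lipschitz(2)[OF B(2) _ tx(2) tz'] B(1) z0 by (simp add: z'_def)
    also have "\<dots> < r / 8" using nk B(1) \<kappa>(3) by (metis add_pos_pos less_le_trans mult_strict_left_mono zero_less_one)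
    finally have "norm (p - z') < r" using norm_triangle_ineq[of "p - z" "z - z'"] zb by simp
    then have "z' \<in> frontier \<Omega>" using frontier_iff[of z'] by (simp add: dist_norm z'_def)
    then have d': "bdist x' \<le> norm (x' - z')" using infdist_le[of z' "frontier \<Omega>" x'] by (simp add: dist_norm)
    have tt: "tang x' - tang z' = tang x - tang z" by (simp add: z'_def k_def)
    have hh: "(height x' - height z') - (height x - height z)
        = ((f (tang x + k) - f (tang x)) - (f (tang z + k) - f (tang z))) - (depth x' - depth x)"
      using z0 depth_point[of "tang z + k" 0] by (simp add: depth_def z'_def k_def)
    have "norm (x' - z') \<le> norm (x - z) + \<bar>(height x' - height z') - (height x - height z)\<bar>"
    proof -
      have "(tang x' - tang z', height x' - height z')
          = (tang x - tang z, height x - height z) + (0, (height x' - height z') - (height x - height z))"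
        by (simp add: tt)
      then have "norm (x' - z') \<le> norm (tang x - tang z, height x - height z)
          + norm (0 :: real ^ 'd, (height x' - height z') - (height x - height z))"
        unfolding norm_coords[of x' z'] by (metis norm_triangle_ineq)
      then show ?thesis by (simp add: norm_coords[of x z] norm_Pair)
    qed
    also have "\<bar>(height x' - height z') - (height x - height z)\<bar>
        \<le> M * norm k * norm (tang x - tang z) + \<bar>depth x' - depth x\<bar>"
      unfolding hh using increment_lipschitz[of "tang x" k "tang z"] by linarith
    also have "M * norm k * norm (tang x - tang z) \<le> M * norm k * bdist x"
      using M_nonneg tang_le[of x z] z(2) by (intro mult_left_mono) auto
    finally have main: "bdist x' \<le> bdist x + M * norm k * bdist x + \<bar>depth x' - depth x\<bar>"
      using d' z(2) by simp
    define s where "s = sqrt (bdist x)"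
    define e where "e = \<bar>sqrt (depth x) - sqrt (depth x')\<bar>"
    have s: "0 \<le> s" "bdist x = s\<^sup>2" "s \<le> sqrt \<kappa>" using d by (auto simp: s_def infdist_nonneg)
    have e: "0 \<le> e" by (simp add: e_def)
    have dep: "0 \<le> depth x" "0 \<le> depth x'" using depth_nonneg in_big x x' by auto
    have "depth x \<le> (B + 1) * s\<^sup>2"
      using depth_lipschitz(1)[OF B(2) _ tx] B(1) z0 z(2) s(2) by simp
    also have "\<dots> \<le> ((B + 1) * s)\<^sup>2" using B(1) by (simp add: power2_eq_square mult_left_mono algebra_simps)
    finally have sd: "sqrt (depth x) \<le> (B + 1) * s" using s(1) B(1) by (intro real_le_lsqrt) auto
    have "\<bar>depth x' - depth x\<bar> = e * (sqrt (depth x) + sqrt (depth x'))"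
      using abs_diff_sqrt[OF dep] by (simp add: e_def abs_minus_commute)
    also have "\<dots> \<le> e * (2 * ((B + 1) * s) + e)"
      using sd e by (intro mult_left_mono) (auto simp: e_def)
    finally have ed: "\<bar>depth x' - depth x\<bar> \<le> 2 * (B + 1) * s * e + e\<^sup>2"
      by (simp add: power2_eq_square algebra_simps)
    have "M * norm k * s\<^sup>2 \<le> M * sqrt \<kappa> * s * norm k"
      using mult_left_mono[OF s(3), of "M * norm k * s"] M_nonneg s(1) by (simp add: power2_eq_square mult_ac)
    also have "\<dots> \<le> C * s * norm k" using s(1) B(1) by (intro mult_right_mono) (auto simp: C_def)
    finally have Mk: "M * norm k * s\<^sup>2 \<le> C * s * norm k" .
    have "2 * (B + 1) * s * e \<le> 2 * C * s * e"
      using s(1) e M_nonneg \<kappa>(1) by (intro mult_right_mono) (auto simp: C_def)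
    moreover have "e\<^sup>2 \<le> (C * (norm k + e))\<^sup>2"
    proof (rule power_mono)
      have "1 * e \<le> C * (norm k + e)" using e C M_nonneg B(1) \<kappa>(1) by (intro mult_mono) (auto simp: C_def)
      then show "e \<le> C * (norm k + e)" by simp
    qed (rule e)
    moreover have "0 \<le> C * s * norm k" using C s(1) by simp
    moreover have "(s + C * (norm k + e))\<^sup>2 = s\<^sup>2 + 2 * C * s * norm k + 2 * C * s * e + (C * (norm k + e))\<^sup>2"
      by (simp add: power2_eq_square algebra_simps)
    ultimately have "bdist x' \<le> (s + C * (norm k + e))\<^sup>2" using main[unfolded s(2)] Mk ed by linarith
    then have "sqrt (bdist x') \<le> s + C * (norm k + e)" using s(1) C e by (intro real_le_lsqrt) auto
    then show ?thesis by (simp add: s_def e_def k_def norm_minus_commute)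
  qed
  then show ?thesis using \<kappa>(1) C by (intro exI[of _ \<kappa>] exI[of _ C] conjI) auto
qed

text \<open>Away from the boundary the square root is Lipschitz, and for points that are tangentially far apart the
bound is trivial, as \<open>rho\<close> is bounded on \<open>\<Omega>\<close>.\<close>

lemma rho_le_chart_dist:
  "\<exists>C>0. \<forall>x\<in>\<Omega> \<inter> ball p (3 * r / 4). \<forall>x'\<in>\<Omega> \<inter> ball p (3 * r / 4). rho \<Omega> x x' \<le> C * chart_dist x x'"
proof -
  obtain \<kappa> C1 where \<kappa>: "0 < \<kappa>" and C1: "0 < C1"
    and near: "\<forall>x\<in>\<Omega> \<inter> ball p (3 * r / 4). \<forall>x'\<in>\<Omega> \<inter> ball p (3 * r / 4).
      bdist x < \<kappa> \<and> norm (tang x - tang x') < \<kappa> \<longrightarrow> sqrt (bdist x') \<le> sqrt (bdist x) + C1 * chart_dist x x'"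
    using sqrt_bdist_near_boundary by blast
  obtain \<rho> where \<rho>: "\<And>x. x \<in> \<Omega> \<Longrightarrow> norm (tang x) \<le> \<rho> \<and> \<bar>height x\<bar> \<le> \<rho>" using coords_bounded by blast
  obtain \<Delta> where \<Delta>: "\<And>x. x \<in> \<Omega> \<Longrightarrow> depth x \<le> \<Delta>" using depth_bounded by blast
  obtain C2 where C2: "0 < C2" "\<forall>x x'. norm (tang x) \<le> \<rho> \<and> norm (tang x') \<le> \<rho> \<and> 0 \<le> depth x \<and> depth x \<le> \<Delta> \<and>
     0 \<le> depth x' \<and> depth x' \<le> \<Delta> \<longrightarrow> norm (x - x') \<le> C2 * chart_dist x x'"
    using norm_le_chart_dist[of \<rho> \<Delta>] by blast
  obtain D where D: "0 < D" "\<And>x y. x \<in> \<Omega> \<Longrightarrow> y \<in> \<Omega> \<Longrightarrow> rho \<Omega> x y \<le> D"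
    using rho_bounded[OF compact_imp_bounded[OF compact_\<Omega>]] by blast
  define C where "C = C1 + C2 / sqrt \<kappa> + D / \<kappa>"
  have C: "0 < C" using C1 C2(1) D(1) \<kappa> by (auto simp: C_def intro!: add_pos_pos)
  have parts: "C1 \<le> C" "C2 / sqrt \<kappa> \<le> C" "D / \<kappa> \<le> C" using C1 C2(1) D(1) \<kappa> by (auto simp: C_def)
  have nd: "norm (x - x') \<le> C2 * chart_dist x x'"
    if "x \<in> \<Omega> \<inter> ball p (3 * r / 4)" "x' \<in> \<Omega> \<inter> ball p (3 * r / 4)" for x x'
  proof -
    have "x \<in> ball p r" "x' \<in> ball p r" using that r_pos by auto
    then have "0 \<le> depth x" "0 \<le> depth x'" using that depth_nonneg by auto
    then show ?thesis using that \<rho> \<Delta> by (intro C2(2)[rule_format]) auto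
  qed
  have one: "sqrt (bdist x') \<le> sqrt (bdist x) + C * chart_dist x x'"
    if x: "x \<in> \<Omega> \<inter> ball p (3 * r / 4)" and x': "x' \<in> \<Omega> \<inter> ball p (3 * r / 4)" for x x'
  proof -
    have cd: "0 \<le> chart_dist x x'" by simp
    consider "bdist x < \<kappa>" "norm (tang x - tang x') < \<kappa>" | "\<kappa> \<le> bdist x" | "\<kappa> \<le> norm (tang x - tang x')"
      by linarith
    then show ?thesis
    proof cases
      case 1
      have "C1 * chart_dist x x' \<le> C * chart_dist x x'" by (rule mult_right_mono[OF parts(1) cd])
      then show ?thesis using near[rule_format, OF x x'] 1 by linarith
    next
      case 2
      have "sqrt (bdist x') - sqrt (bdist x) \<le> norm (x - x') / sqrt \<kappa>"
      proof (cases "bdist x \<le> bdist x'")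
        case True
        have "(sqrt (bdist x') - sqrt (bdist x)) * sqrt \<kappa> \<le> (sqrt (bdist x') - sqrt (bdist x)) * (sqrt (bdist x') + sqrt (bdist x))"
          using True 2 \<kappa> by (intro mult_left_mono) (auto intro: add_increasing simp: infdist_nonneg)
        also have "\<dots> = bdist x' - bdist x" by (simp add: algebra_simps infdist_nonneg)
        also have "\<dots> \<le> norm (x - x')" using bdist_lipschitz[of x' x] by linarith
        finally show ?thesis using \<kappa> by (simp add: pos_le_divide_eq)
      next
        case False
        then have "sqrt (bdist x') \<le> sqrt (bdist x)" by simp
        then show ?thesis using \<kappa> by (smt (verit) divide_nonneg_nonneg norm_ge_zero real_sqrt_ge_zero)
      qed
      also have "\<dots> \<le> C2 * chart_dist x x' / sqrt \<kappa>" using nd[OF x x'] \<kappa> by (intro divide_right_mono) auto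
      also have "\<dots> = C2 / sqrt \<kappa> * chart_dist x x'" by simp
      also have "\<dots> \<le> C * chart_dist x x'" by (rule mult_right_mono[OF parts(2) cd])
      finally show ?thesis by linarith
    next
      case 3
      have "sqrt (bdist x') - sqrt (bdist x) \<le> rho \<Omega> x x'" using norm_ge_zero[of "x - x'"] unfolding rho_def by linarith
      also have "\<dots> \<le> D" using D(2) x x' by auto
      also have "\<dots> = D / \<kappa> * \<kappa>" using \<kappa> by simp
      also have "\<dots> \<le> C * chart_dist x x'" using parts(3) 3 \<kappa> C by (intro mult_mono) auto
      finally show ?thesis by linarith
    qed
  qed
  have "rho \<Omega> x x' \<le> (C2 + C) * chart_dist x x'"
    if x: "x \<in> \<Omega> \<inter> ball p (3 * r / 4)" and x': "x' \<in> \<Omega> \<inter> ball p (3 * r / 4)" for x x'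
  proof -
    have "chart_dist x' x = chart_dist x x'" by (simp add: norm_minus_commute abs_minus_commute)
    then have "\<bar>sqrt (bdist x) - sqrt (bdist x')\<bar> \<le> C * chart_dist x x'"
      using one[OF x x'] one[OF x' x] by (simp only: abs_le_iff) linarith
    then show ?thesis using nd[OF x x'] unfolding rho_def distrib_right by linarith
  qed
  then show ?thesis using C C2(1) by (intro exI[of _ "C2 + C"]) auto
qed

end

section \<open>The partition of unity in a chart\<close>

lemma one_plus_sum_le_prod:
  fixes a :: "'i \<Rightarrow> real"
  assumes "\<And>i. i \<in> A \<Longrightarrow> 0 \<le> a i"
  shows "1 + (\<Sum>i\<in>A. a i) \<le> (\<Prod>i\<in>A. 1 + a i)"
  using assms
proof (induction A rule: infinite_finite_induct)
  case (insert j A)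
  have "1 + (\<Sum>i\<in>A. a i) + a j * 1 \<le> (\<Prod>i\<in>A. 1 + a i) + a j * (\<Prod>i\<in>A. 1 + a i)"
    using insert by (intro add_mono mult_left_mono prod_ge_1) auto
  then show ?case using insert by (simp add: algebra_simps)
qed auto

context subgraph_chart
begin

text \<open>The index set is a grid: \<open>k\<close> selects a tangential node and \<open>m\<close> a depth \<open>H (\<nu> m)\<^sup>2\<close> below the graph
at that node. The tangential factors are tensor products of the univariate partition. The depth itself
is not a polynomial; in the factor for the depth it is replaced by the quadratic polynomial \<open>g k\<close>, the
Taylor polynomial at the node plus \<open>M \<bar>y - w\<bar>\<^sup>2\<close>. Then
\<open>depth \<le> g k \<le> depth + 2 M \<bar>y - w\<bar>\<^sup>2\<close>, so \<open>g k\<close> is nonnegative on the chart, and the square roots of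
\<open>g k\<close> and of the depth differ by a multiple of \<open>\<bar>y - w\<bar>\<close>, which the tangential factors pay for. Although
\<open>g k\<close> depends on \<open>k\<close>, the products still sum to 1: first over \<open>m\<close> with \<open>k\<close> fixed, then over \<open>k\<close>.
Outside the chart \<open>g k\<close> may be negative, and only the exponential bound is left.\<close>

lemma chart_partition:
  assumes l: "0 < l"
  shows "\<exists>C\<ge>0. \<forall>n\<ge>1. \<exists>(I :: (('d \<Rightarrow> nat) \<times> nat) set) P a. local_partition \<Omega> l (ball p (r / 2)) C n I P a"
proof -
  obtain L where L: "0 < L" "\<And>x. x \<in> \<Omega> \<Longrightarrow> norm (tang x) \<le> L \<and> \<bar>height x\<bar> \<le> L" using coords_bounded by blast
  obtain \<Delta> where \<Delta>: "\<And>x. x \<in> \<Omega> \<Longrightarrow> depth x \<le> \<Delta>" using depth_bounded by blast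
  define d where "d = CARD('d)"
  have d: "1 \<le> d" by (simp add: d_def Suc_leI)
  define \<rho> where "\<rho> = real d * L"
  have L\<rho>: "L \<le> \<rho>" using d L(1) by (simp add: \<rho>_def)
  obtain B where B: "1 \<le> B" "\<forall>y. norm y \<le> \<rho> \<longrightarrow> norm (G y) \<le> B \<and> \<bar>f y\<bar> \<le> B \<and>
     (\<forall>z. norm z \<le> \<rho> \<longrightarrow> \<bar>f y - f z\<bar> \<le> B * norm (y - z))"
    using bounds_on_ball[of \<rho>] by blast
  define H where "H = B + B * (2 * \<rho>) + M * (2 * \<rho>)\<^sup>2 + L + 1"
  have \<rho>0: "0 \<le> \<rho>" using L(1) L\<rho> by linarith
  have H: "0 < H" unfolding H_def using B(1) \<rho>0 M_nonneg L(1)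
    by (intro add_nonneg_pos add_nonneg_nonneg mult_nonneg_nonneg) auto
  obtain C2 where C2: "0 < C2" "\<forall>x x'. norm (tang x) \<le> \<rho> \<and> norm (tang x') \<le> \<rho> \<and> 0 \<le> depth x \<and> depth x \<le> max \<Delta> H \<and>
     0 \<le> depth x' \<and> depth x' \<le> max \<Delta> H \<longrightarrow> norm (x - x') \<le> C2 * chart_dist x x'"
    using norm_le_chart_dist[of \<rho> "max \<Delta> H"] by blast
  obtain C3 where C3: "0 < C3" "\<forall>x\<in>\<Omega> \<inter> ball p (3 * r / 4). \<forall>x'\<in>\<Omega> \<inter> ball p (3 * r / 4). rho \<Omega> x x' \<le> C3 * chart_dist x x'"
    using rho_le_chart_dist by blast
  obtain D where D: "0 < D" "\<And>x y. x \<in> \<Omega> \<Longrightarrow> y \<in> \<Omega> \<Longrightarrow> rho \<Omega> x y \<le> D"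
    using rho_bounded[OF compact_imp_bounded[OF compact_\<Omega>]] by blast
  define C4 where "C4 = (1 + sqrt (2 * M)) * (4 * L) + sqrt H"
  define C5 where "C5 = C3 + D * (4 / r) * C2"
  define C6 where "C6 = 1 + C5 * C4"
  have C4: "0 < C4" unfolding C4_def using M_nonneg L(1) H by (intro add_nonneg_pos) auto
  have C5: "0 < C5" unfolding C5_def using C3(1) D(1) r_pos C2(1) by (intro add_pos_pos) auto
  have C6: "1 \<le> C6" using C4 C5 by (simp add: C6_def)
  obtain K C1 where K: "1 \<le> K" and C1: "0 < C1" and part: "\<forall>n\<ge>1. \<exists>T v. localized_partition l C1 n (K * n) T v"
    using localized_partition_exists[of l] l by auto
  define C where "C = real ((d + 2) * K) + C6 powr l * C1 ^ Suc d + 14 ^ K"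
  have C0: "0 \<le> C" using C1 by (simp add: C_def)
  have "\<exists>(I :: (('d \<Rightarrow> nat) \<times> nat) set) P a. local_partition \<Omega> l (ball p (r / 2)) C n I P a" if n: "n \<ge> 1" for n
  proof -
    define N where "N = K * n"
    obtain T \<nu> where lp: "localized_partition l C1 n N T \<nu>" using part n unfolding N_def by blast
    have T_deg: "degree (T m) \<le> N" and \<nu>: "0 \<le> \<nu> m" "\<nu> m \<le> 1" if "m < N" for m
      using lp that unfolding localized_partition_def by auto
    have T_sum: "(\<Sum>m<N. poly (T m) u) = 1" for u using lp unfolding localized_partition_def by auto
    have T_nonneg: "0 \<le> poly (T m) (1 - 2 * x\<^sup>2)" if "m < N" "0 \<le> x" "x \<le> 1" for m x
      using lp that unfolding localized_partition_def by auto
    have T_dec: "(\<Sum>m<N. poly (T m) (1 - 2 * x\<^sup>2) * (1 + real n * \<bar>x - \<nu> m\<bar>) powr l) \<le> C1" if "0 \<le> x" "x \<le> 1" for x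
      using lp that unfolding localized_partition_def by auto
    have T_grow: "\<bar>poly (T m) u\<bar> \<le> 7 ^ N" if "m < N" "\<bar>u\<bar> \<le> 3" for m u
      using lp that unfolding localized_partition_def by auto
    define X where "X = (\<Pi>\<^sub>E i\<in>(UNIV :: 'd set). {..<N})"
    have finX: "finite X" unfolding X_def by (intro finite_PiE) auto
    have X: "k i < N" if "k \<in> X" for k i using that by (auto simp: X_def PiE_def Pi_def)
    define node where "node = (\<lambda>k :: 'd \<Rightarrow> nat. \<chi> i. L * (1 - 2 * (\<nu> (k i))\<^sup>2))"
    define g where "g = (\<lambda>k x. f (node k) + G (node k) \<bullet> (tang x - node k) + M * (norm (tang x - node k))\<^sup>2 - height x)"
    define Y where "Y = (\<lambda>k x. \<Prod>i\<in>UNIV. poly (T (k i)) (tang x $ i / L))"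
    define P where "P = (\<lambda>(k, m) x. Y k x * poly (T m) (1 - 2 * (g k x / H)))"
    define site where "site = (\<lambda>(k, m). point (node k) (H * (\<nu> m)\<^sup>2))"
    \<comment> \<open>A grid point outside the ball need not belong to \<open>\<Omega>\<close>; since it is far from the points of the half
      ball in the chart distance, any point of \<open>\<Omega>\<close> can stand in for it.\<close>
    define a where "a = (\<lambda>j. if site j \<in> ball p (3 * r / 4) then site j else p)"
    have Y_sum: "(\<Sum>k\<in>X. \<Prod>i\<in>UNIV. h i (k i)) = (\<Prod>i\<in>UNIV. \<Sum>m<N. h i m)" for h :: "'d \<Rightarrow> nat \<Rightarrow> real"
      unfolding X_def by (subst prod_sum_PiE) auto
    have node_le: "norm (node k) \<le> \<rho>" if "k \<in> X" for k
    proof -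
      have "norm (node k) \<le> (\<Sum>i\<in>UNIV. \<bar>node k $ i\<bar>)" by (rule norm_le_l1_cart)
      also have "\<dots> \<le> (\<Sum>i\<in>(UNIV :: 'd set). L)"
      proof (rule sum_mono)
        fix i
        have "(\<nu> (k i))\<^sup>2 \<le> 1" using \<nu>[OF X[OF that, of i]] by (simp add: power_le_one)
        then have "\<bar>1 - 2 * (\<nu> (k i))\<^sup>2\<bar> \<le> 1" using zero_le_power2[of "\<nu> (k i)"] by (simp only: abs_le_iff) linarith
        then show "\<bar>node k $ i\<bar> \<le> L" using L(1) by (simp add: node_def abs_mult)
      qed
      also have "\<dots> = \<rho>" by (simp add: \<rho>_def d_def)
      finally show ?thesis .
    qed
    have g_H: "\<bar>g k x\<bar> \<le> H" if "k \<in> X" "x \<in> \<Omega>" for k x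
    proof -
      have "norm (tang x - node k) \<le> 2 * \<rho>"
        using norm_triangle_ineq4[of "tang x" "node k"] node_le[OF that(1)] L(2)[OF that(2)] L\<rho> by linarith
      then have "norm (G (node k)) * norm (tang x - node k) \<le> B * (2 * \<rho>)"
        and "M * (norm (tang x - node k))\<^sup>2 \<le> M * (2 * \<rho>)\<^sup>2"
        using B(2) node_le[OF that(1)] M_nonneg B(1)
        by (blast intro: mult_mono' norm_ge_zero, intro mult_left_mono power_mono norm_ge_zero)
      moreover have "\<bar>G (node k) \<bullet> (tang x - node k)\<bar> \<le> norm (G (node k)) * norm (tang x - node k)"
        by (rule Cauchy_Schwarz_ineq2)
      moreover have "\<bar>f (node k)\<bar> \<le> B" using B(2) node_le[OF that(1)] by blast
      moreover have "0 \<le> M * (norm (tang x - node k))\<^sup>2" using M_nonneg by simp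
      ultimately show ?thesis using L(2)[OF that(2)] unfolding g_def H_def by linarith
    qed
    have g_depth: "depth x \<le> g k x" "g k x \<le> depth x + 2 * M * (norm (tang x - node k))\<^sup>2" for k x
      using taylor[of "tang x" "node k"] by (auto simp: g_def depth_def abs_le_iff)
    have coord: "\<bar>tang x $ i / L\<bar> \<le> 1" if "x \<in> \<Omega>" for x i
      using component_le_norm_cart[of "tang x" i] L(2)[OF that] L(1) by simp
    \<comment> \<open>The variables in which the tangential factors are localized, and below \<open>\<eta>\<close> for the depth.\<close>
    define \<xi> where "\<xi> = (\<lambda>x i. sqrt ((1 - tang x $ i / L) / 2))"
    have \<xi>: "0 \<le> \<xi> x i" "\<xi> x i \<le> 1" "1 - 2 * (\<xi> x i)\<^sup>2 = tang x $ i / L" if "x \<in> \<Omega>" for x i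
    proof -
      have "tang x $ i / L \<le> 1" "- 1 \<le> tang x $ i / L" using coord[OF that, of i] by linarith+
      then show "0 \<le> \<xi> x i" "\<xi> x i \<le> 1" "1 - 2 * (\<xi> x i)\<^sup>2 = tang x $ i / L" by (simp_all add: \<xi>_def diff_divide_distrib)
    qed
    have T_coord: "0 \<le> poly (T m) (tang x $ i / L)" if "m < N" "x \<in> \<Omega>" for m i x
      using T_nonneg[OF that(1) \<xi>(1,2)[OF that(2)], of i] \<xi>(3)[OF that(2), of i] by simp
    have Y_nonneg: "0 \<le> Y k x" if "k \<in> X" "x \<in> \<Omega>" for k x
      unfolding Y_def using that X by (intro prod_nonneg T_coord) auto
    have Y_one: "(\<Sum>k\<in>X. Y k x) = 1" for x
      unfolding Y_def Y_sum[of "\<lambda>i m. poly (T m) (tang x $ i / L)"] T_sum by simp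
    have "finite (X \<times> {..<N})" using finX by simp
    moreover have "a ` (X \<times> {..<N}) \<subseteq> \<Omega>"
    proof (rule image_subsetI)
      fix j assume "j \<in> X \<times> {..<N}"
      have dj: "0 \<le> depth (site j)" using H by (cases j) (simp add: site_def)
      show "a j \<in> \<Omega>"
      proof (cases "site j \<in> ball p (3 * r / 4)")
        case True
        then have "site j \<in> ball p r" using r_pos by auto
        then show ?thesis using depth_nonneg dj True by (simp add: a_def)
      next
        case False
        then show ?thesis using p_in by (simp add: a_def)
      qed
    qed
    moreover have "polynomial_degree_le (C * real n) (P j)" if j: "j \<in> X \<times> {..<N}" for j
    proof -
      obtain k m where km: "j = (k, m)" "k \<in> X" "m < N" using j by auto
      have lin: "linear (\<lambda>z. fst (R z) $ i)" "linear (\<lambda>z. snd (R z))" for i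
        using R_linear by (simp_all add: linear_iff)
      have tang_deg: "polynomial_degree_le 1 (\<lambda>x. tang x $ i)" and height_deg: "polynomial_degree_le 2 height" for i
        using degree_le_affine[OF lin(1)[of i], of 1 v] degree_le_affine[OF lin(2), of 2 v]
        unfolding tang_def height_def[abs_def] by simp_all
      have "polynomial_degree_le (real N * 1) (\<lambda>x. poly (T (k i)) (tang x $ i / L))" for i
        using degree_le_poly[OF degree_le_cmult[OF tang_deg, of "1 / L"] T_deg[OF X[OF km(2)]], of i i] by simp
      then have Y_deg: "polynomial_degree_le (real d * real N) (Y k)"
        unfolding Y_def d_def using degree_le_prod[of "UNIV :: 'd set" "real N" "\<lambda>i x. poly (T (k i)) (tang x $ i / L)"] by simp
      have diff_deg: "polynomial_degree_le 1 (\<lambda>x. (tang x - node k) $ i)" for i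
        using degree_le_diff[OF tang_deg[of i] degree_le_const[of 1 "node k $ i"]] by simp
      have "polynomial_degree_le 2 (\<lambda>x. (tang x - node k) $ i * (tang x - node k) $ i)" for i
        using degree_le_mult[OF diff_deg[of i] diff_deg[of i]] by simp
      then have "polynomial_degree_le 2 (\<lambda>x. f (node k) + (\<Sum>i\<in>UNIV. G (node k) $ i * (tang x - node k) $ i)
          + M * (\<Sum>i\<in>UNIV. (tang x - node k) $ i * (tang x - node k) $ i) - height x)"
        by (intro degree_le_add degree_le_diff degree_le_cmult degree_le_sum degree_le_const height_deg degree_le_mono[OF diff_deg]) auto
      moreover have "(\<lambda>x. f (node k) + (\<Sum>i\<in>UNIV. G (node k) $ i * (tang x - node k) $ i)
          + M * (\<Sum>i\<in>UNIV. (tang x - node k) $ i * (tang x - node k) $ i) - height x) = g k"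
        unfolding g_def power2_norm_eq_inner inner_vec_def by (simp add: fun_eq_iff)
      ultimately have "polynomial_degree_le 2 (g k)" by simp
      then have "polynomial_degree_le 2 (\<lambda>x. 1 - (2 / H) * g k x)" by (intro degree_le_diff degree_le_const degree_le_cmult) auto
      then have "polynomial_degree_le (real N * 2) (\<lambda>x. poly (T m) (1 - (2 / H) * g k x))"
        using T_deg[OF km(3)] by (rule degree_le_poly) simp
      from degree_le_mult[OF Y_deg this] have "polynomial_degree_le (real d * real N + real N * 2) (P j)"
        by (simp add: P_def km(1))
      moreover have "real d * real N + real N * 2 \<le> C * real n"
      proof -
        have "real d * real N + real N * 2 = real ((d + 2) * K) * real n" by (simp add: N_def algebra_simps)
        also have "\<dots> \<le> C * real n" unfolding C_def using C1 by (intro mult_right_mono) auto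
        finally show ?thesis .
      qed
      ultimately show ?thesis by (rule degree_le_mono)
    qed
    moreover have "(\<Sum>j\<in>X \<times> {..<N}. P j x) = 1" for x
      unfolding sum.cartesian_product' P_def
      by (simp add: T_sum Y_one flip: sum_distrib_left)
    moreover have "(\<Sum>j\<in>X \<times> {..<N}. \<bar>P j x\<bar>) \<le> C ^ n" if x: "x \<in> \<Omega>" for x
    proof -
      have "(\<Sum>j\<in>X \<times> {..<N}. \<bar>P j x\<bar>) = (\<Sum>k\<in>X. \<Sum>m<N. \<bar>P (k, m) x\<bar>)"
        by (simp add: sum.cartesian_product')
      also have "\<dots> \<le> (\<Sum>k\<in>X. \<Sum>m<N. Y k x * 7 ^ N)"
      proof (intro sum_mono)
        fix k m assume km: "k \<in> X" "m \<in> {..<N}"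
        have "\<bar>g k x / H\<bar> \<le> 1" using g_H[OF km(1) x] H by simp
        then have "\<bar>1 - 2 * (g k x / H)\<bar> \<le> 3" by (simp only: abs_le_iff) linarith
        then show "\<bar>P (k, m) x\<bar> \<le> Y k x * 7 ^ N"
          using T_grow[of m] km Y_nonneg[OF km(1) x] by (auto simp: P_def abs_mult intro!: mult_left_mono)
      qed
      also have "\<dots> = (\<Sum>k\<in>X. Y k x) * (real N * 7 ^ N)" by (simp add: sum_distrib_right sum_distrib_left mult_ac)
      also have "\<dots> = real N * 7 ^ N" by (simp add: Y_one)
      also have "\<dots> \<le> 2 ^ N * 7 ^ N" by (intro mult_right_mono) auto
      also have "\<dots> = 14 ^ N" by (simp flip: power_mult_distrib)
      also have "\<dots> = (14 ^ K) ^ n" by (simp add: N_def power_mult)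
      also have "\<dots> \<le> C ^ n" unfolding C_def using C1 by (intro power_mono) auto
      finally show ?thesis .
    qed
    moreover have "decay_sum \<Omega> l n (X \<times> {..<N}) P a x \<le> C" if x: "x \<in> \<Omega> \<inter> ball p (r / 2)" for x
    proof -
      have x\<Omega>: "x \<in> \<Omega>" and xr: "x \<in> ball p r" and x34: "x \<in> ball p (3 * r / 4)" using x r_pos by auto
      have dep: "0 \<le> depth x" using depth_nonneg[OF xr] x\<Omega> by blast
      have tx: "norm (tang x) \<le> \<rho>" using L(2)[OF x\<Omega>] L\<rho> by linarith
      define \<eta> where "\<eta> = (\<lambda>k. sqrt (g k x / H))"
      define A where "A = (\<lambda>k. \<Sum>i\<in>UNIV. \<bar>\<xi> x i - \<nu> (k i)\<bar>)"
      define V where "V = (\<lambda>k. (\<Prod>i\<in>UNIV. 1 + real n * \<bar>\<xi> x i - \<nu> (k i)\<bar>))"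
      have \<eta>: "0 \<le> \<eta> k" "\<eta> k \<le> 1" "(\<eta> k)\<^sup>2 = g k x / H" if "k \<in> X" for k
        using g_depth(1)[of x k] dep g_H[OF that x\<Omega>] H by (auto simp: \<eta>_def)
      have dist_le: "chart_dist x (site (k, m)) \<le> C4 * (A k + \<bar>\<eta> k - \<nu> m\<bar>)" if km: "k \<in> X" "m < N" for k m
      proof -
        define h where "h = norm (tang x - node k)"
        have "h \<le> (\<Sum>i\<in>UNIV. \<bar>(tang x - node k) $ i\<bar>)" unfolding h_def by (rule norm_le_l1_cart)
        also have "\<dots> \<le> (\<Sum>i\<in>UNIV. 4 * L * \<bar>\<xi> x i - \<nu> (k i)\<bar>)"
        proof (rule sum_mono)
          fix i
          have "(tang x - node k) $ i = L * (1 - 2 * (\<xi> x i)\<^sup>2) - L * (1 - 2 * (\<nu> (k i))\<^sup>2)"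
            using L(1) by (simp add: \<xi>(3)[OF x\<Omega>] node_def)
          also have "\<dots> = - (2 * L * ((\<xi> x i - \<nu> (k i)) * (\<xi> x i + \<nu> (k i))))" by (simp add: power2_eq_square algebra_simps)
          finally have "\<bar>(tang x - node k) $ i\<bar> = 2 * L * \<bar>\<xi> x i - \<nu> (k i)\<bar> * \<bar>\<xi> x i + \<nu> (k i)\<bar>"
            using L(1) by (simp add: abs_mult)
          also have "\<dots> \<le> 2 * L * \<bar>\<xi> x i - \<nu> (k i)\<bar> * 2"
            using \<xi>(1,2)[OF x\<Omega>, of i] \<nu>[OF X[OF km(1), of i]] L(1) by (intro mult_left_mono) auto
          finally show "\<bar>(tang x - node k) $ i\<bar> \<le> 4 * L * \<bar>\<xi> x i - \<nu> (k i)\<bar>" by simp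
        qed
        also have "\<dots> = 4 * L * A k" by (simp add: A_def sum_distrib_left)
        finally have h: "h \<le> 4 * L * A k" .
        have h0: "0 \<le> h" by (simp add: h_def)
        have sg: "sqrt (g k x) = sqrt H * \<eta> k" using H by (simp add: \<eta>_def real_sqrt_divide)
        have ss: "sqrt (depth (site (k, m))) = sqrt H * \<nu> m"
          using \<nu>[OF km(2)] by (simp add: site_def real_sqrt_mult)
        have "sqrt (g k x) \<le> sqrt (depth x + 2 * M * h\<^sup>2)" using g_depth(2)[of k x] by (simp add: h_def)
        also have "\<dots> \<le> sqrt (depth x) + sqrt (2 * M * h\<^sup>2)" using dep M_nonneg by (intro sqrt_add_le_add_sqrt) auto
        also have "sqrt (2 * M * h\<^sup>2) = sqrt (2 * M) * h" using h0 by (simp add: real_sqrt_mult)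
        finally have "\<bar>sqrt (depth x) - sqrt (g k x)\<bar> \<le> sqrt (2 * M) * h"
          using g_depth(1)[of x k] real_sqrt_le_mono[of "depth x" "g k x"] by linarith
        moreover have "\<bar>sqrt (g k x) - sqrt (depth (site (k, m)))\<bar> = sqrt H * \<bar>\<eta> k - \<nu> m\<bar>"
          unfolding sg ss using H by (simp add: abs_mult flip: right_diff_distrib)
        ultimately have "\<bar>sqrt (depth x) - sqrt (depth (site (k, m)))\<bar> \<le> sqrt (2 * M) * h + sqrt H * \<bar>\<eta> k - \<nu> m\<bar>" by linarith
        moreover have "norm (tang x - tang (site (k, m))) = h" by (simp add: site_def h_def)
        ultimately have "chart_dist x (site (k, m)) \<le> (1 + sqrt (2 * M)) * h + sqrt H * \<bar>\<eta> k - \<nu> m\<bar>"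
          by (simp add: algebra_simps)
        also have "\<dots> \<le> (1 + sqrt (2 * M)) * (4 * L * A k) + sqrt H * \<bar>\<eta> k - \<nu> m\<bar>"
          using h M_nonneg by (intro add_right_mono mult_left_mono) auto
        also have "\<dots> \<le> C4 * A k + C4 * \<bar>\<eta> k - \<nu> m\<bar>"
        proof (rule add_mono)
          have "0 \<le> A k" by (auto simp: A_def intro: sum_nonneg)
          then have "(1 + sqrt (2 * M)) * (4 * L) * A k \<le> C4 * A k" using H by (intro mult_right_mono) (auto simp: C4_def)
          then show "(1 + sqrt (2 * M)) * (4 * L * A k) \<le> C4 * A k" by (simp only: mult.assoc)
          show "sqrt H * \<bar>\<eta> k - \<nu> m\<bar> \<le> C4 * \<bar>\<eta> k - \<nu> m\<bar>"
            using M_nonneg L(1) by (intro mult_right_mono) (auto simp: C4_def)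
        qed
        finally show ?thesis by (simp add: distrib_left)
      qed
      have weight: "(1 + real n * rho \<Omega> x (a (k, m))) powr l
          \<le> C6 powr l * (V k powr l * (1 + real n * \<bar>\<eta> k - \<nu> m\<bar>) powr l)" if km: "k \<in> X" "m < N" for k m
      proof -
        define E where "E = chart_dist x (site (k, m))"
        have E: "0 \<le> E" by (simp add: E_def)
        have site_depth: "depth (site (k, m)) = H * (\<nu> m)\<^sup>2" by (simp add: site_def)
        have sd: "0 \<le> depth (site (k, m))" "depth (site (k, m)) \<le> H"
          using H \<nu>[OF km(2)] unfolding site_depth by (auto simp: mult_left_le power_le_one)
        have "rho \<Omega> x (a (k, m)) \<le> C5 * E"
        proof (cases "site (k, m) \<in> ball p (3 * r / 4)")
          case True
          then have "site (k, m) \<in> ball p r" using r_pos by auto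
          then have "site (k, m) \<in> \<Omega>" using depth_nonneg sd by blast
          then have "rho \<Omega> x (site (k, m)) \<le> C3 * E"
            unfolding E_def using x\<Omega> x34 True by (intro C3(2)[rule_format]) auto
          also have "\<dots> \<le> C5 * E" using E D(1) r_pos C2(1) by (intro mult_right_mono) (auto simp: C5_def)
          finally show ?thesis using True by (simp add: a_def)
        next
          case False
          have "norm (x - site (k, m)) \<le> C2 * E"
            unfolding E_def using tx node_le[OF km(1)] dep sd \<Delta>[OF x\<Omega>]
            by (intro C2(2)[rule_format]) (auto simp: site_def)
          moreover have "r / 4 \<le> norm (x - site (k, m))"
            using norm_triangle_ineq[of "p - x" "x - site (k, m)"] False x by (simp add: dist_norm)
          ultimately have "r / 4 \<le> C2 * E" by linarith
          then have "D * (4 / r) * (r / 4) \<le> D * (4 / r) * (C2 * E)" using D(1) r_pos by (intro mult_left_mono) auto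
          then have "D \<le> D * (4 / r) * C2 * E" using r_pos by (simp add: mult.assoc)
          also have "\<dots> \<le> C5 * E" using E C3(1) by (intro mult_right_mono) (auto simp: C5_def)
          finally show ?thesis using D(2)[OF x\<Omega> p_in] False by (simp add: a_def)
        qed
        also have "\<dots> \<le> C5 * (C4 * (A k + \<bar>\<eta> k - \<nu> m\<bar>))"
          using dist_le[OF km] C5 unfolding E_def by (intro mult_left_mono) auto
        finally have rho_le: "rho \<Omega> x (a (k, m)) \<le> C5 * C4 * (A k + \<bar>\<eta> k - \<nu> m\<bar>)" by simp
        define S where "S = real n * (A k + \<bar>\<eta> k - \<nu> m\<bar>)"
        have S0: "0 \<le> S" by (auto simp: S_def A_def intro!: mult_nonneg_nonneg add_nonneg_nonneg sum_nonneg)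
        have "1 + real n * rho \<Omega> x (a (k, m)) \<le> 1 + real n * (C5 * C4 * (A k + \<bar>\<eta> k - \<nu> m\<bar>))"
          using rho_le by (intro add_left_mono mult_left_mono) auto
        also have "\<dots> = 1 + C5 * C4 * S" by (simp add: S_def)
        also have "\<dots> \<le> C6 * (1 + S)" using C4 C5 S0 by (simp add: C6_def algebra_simps)
        also have "\<dots> \<le> C6 * (V k * (1 + real n * \<bar>\<eta> k - \<nu> m\<bar>))"
        proof (rule mult_left_mono)
          have V: "1 + real n * A k \<le> V k"
            using one_plus_sum_le_prod[of UNIV "\<lambda>i. real n * \<bar>\<xi> x i - \<nu> (k i)\<bar>"]
            by (simp add: A_def V_def sum_distrib_left)
          have "0 \<le> real n * A k" by (auto simp: A_def intro!: mult_nonneg_nonneg sum_nonneg)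
          then have "1 * (real n * \<bar>\<eta> k - \<nu> m\<bar>) \<le> V k * (real n * \<bar>\<eta> k - \<nu> m\<bar>)"
            using V by (intro mult_right_mono) auto
          then show "1 + S \<le> V k * (1 + real n * \<bar>\<eta> k - \<nu> m\<bar>)"
            using V by (simp add: S_def algebra_simps)
        qed (use C6 in auto)
        finally have "(1 + real n * rho \<Omega> x (a (k, m))) powr l \<le> (C6 * (V k * (1 + real n * \<bar>\<eta> k - \<nu> m\<bar>))) powr l"
          using l rho_nonneg[of \<Omega> x "a (k, m)"] by (intro powr_mono2) auto
        then show ?thesis by (simp only: powr_mult)
      qed
      have V_powr: "V k powr l = (\<Prod>i\<in>UNIV. (1 + real n * \<bar>\<xi> x i - \<nu> (k i)\<bar>) powr l)" for k
        unfolding V_def by (rule prod_powr_distrib)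
      have Y_dec: "(\<Sum>k\<in>X. Y k x * V k powr l) \<le> C1 ^ d"
      proof -
        have "(\<Sum>k\<in>X. Y k x * V k powr l)
            = (\<Prod>i\<in>UNIV. \<Sum>m<N. poly (T m) (tang x $ i / L) * (1 + real n * \<bar>\<xi> x i - \<nu> m\<bar>) powr l)"
          unfolding Y_def V_powr prod.distrib[symmetric]
          by (rule Y_sum[of "\<lambda>i m. poly (T m) (tang x $ i / L) * (1 + real n * \<bar>\<xi> x i - \<nu> m\<bar>) powr l"])
        also have "\<dots> \<le> (\<Prod>i\<in>(UNIV :: 'd set). C1)"
        proof (intro prod_mono conjI)
          fix i
          show "0 \<le> (\<Sum>m<N. poly (T m) (tang x $ i / L) * (1 + real n * \<bar>\<xi> x i - \<nu> m\<bar>) powr l)"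
            using T_coord x\<Omega> by (intro sum_nonneg mult_nonneg_nonneg) auto
          show "(\<Sum>m<N. poly (T m) (tang x $ i / L) * (1 + real n * \<bar>\<xi> x i - \<nu> m\<bar>) powr l) \<le> C1"
            using T_dec[OF \<xi>(1,2)[OF x\<Omega>], of i] by (simp only: \<xi>(3)[OF x\<Omega>])
        qed
        finally show ?thesis by (simp add: d_def)
      qed
      have T_g: "0 \<le> poly (T m) (1 - 2 * (g k x / H))" if "k \<in> X" "m < N" for k m
        using T_nonneg[OF that(2) \<eta>(1,2)[OF that(1)]] \<eta>(3)[OF that(1)] by simp
      have "decay_sum \<Omega> l n (X \<times> {..<N}) P a x
          = (\<Sum>k\<in>X. \<Sum>m<N. \<bar>P (k, m) x\<bar> * (1 + real n * rho \<Omega> x (a (k, m))) powr l)"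
        unfolding decay_sum_def by (simp add: sum.cartesian_product')
      also have "\<dots> \<le> (\<Sum>k\<in>X. \<Sum>m<N. C6 powr l * (Y k x * V k powr l) *
          (poly (T m) (1 - 2 * (g k x / H)) * (1 + real n * \<bar>\<eta> k - \<nu> m\<bar>) powr l))"
      proof (intro sum_mono)
        fix k m assume "k \<in> X" "m \<in> {..<N}"
        then have km: "k \<in> X" "m < N" by auto
        have "\<bar>P (k, m) x\<bar> = Y k x * poly (T m) (1 - 2 * (g k x / H))"
          using Y_nonneg[OF km(1) x\<Omega>] T_g[OF km] by (simp add: P_def)
        then have "\<bar>P (k, m) x\<bar> * (1 + real n * rho \<Omega> x (a (k, m))) powr l
           \<le> Y k x * poly (T m) (1 - 2 * (g k x / H)) * (C6 powr l * (V k powr l * (1 + real n * \<bar>\<eta> k - \<nu> m\<bar>) powr l))"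
          using weight[OF km] Y_nonneg[OF km(1) x\<Omega>] T_g[OF km] by (simp add: mult_left_mono)
        then show "\<bar>P (k, m) x\<bar> * (1 + real n * rho \<Omega> x (a (k, m))) powr l \<le> C6 powr l * (Y k x * V k powr l) *
          (poly (T m) (1 - 2 * (g k x / H)) * (1 + real n * \<bar>\<eta> k - \<nu> m\<bar>) powr l)" by (simp only: mult_ac)
      qed
      also have "\<dots> = (\<Sum>k\<in>X. C6 powr l * (Y k x * V k powr l) *
          (\<Sum>m<N. poly (T m) (1 - 2 * (g k x / H)) * (1 + real n * \<bar>\<eta> k - \<nu> m\<bar>) powr l))"
        by (simp add: sum_distrib_left)
      also have "\<dots> \<le> (\<Sum>k\<in>X. C6 powr l * (Y k x * V k powr l) * C1)"
      proof (intro sum_mono mult_left_mono)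
        fix k assume k: "k \<in> X"
        show "(\<Sum>m<N. poly (T m) (1 - 2 * (g k x / H)) * (1 + real n * \<bar>\<eta> k - \<nu> m\<bar>) powr l) \<le> C1"
          using T_dec[OF \<eta>(1,2)[OF k]] by (simp only: \<eta>(3)[OF k])
        show "0 \<le> C6 powr l * (Y k x * V k powr l)" using Y_nonneg[OF k x\<Omega>] by simp
      qed
      also have "\<dots> = C6 powr l * (\<Sum>k\<in>X. Y k x * V k powr l) * C1"
        by (simp add: sum_distrib_left sum_distrib_right)
      also have "\<dots> \<le> C6 powr l * C1 ^ d * C1"
        using Y_dec C1 by (intro mult_right_mono mult_left_mono) auto
      also have "\<dots> \<le> C" by (simp add: C_def)
      finally show ?thesis .
    qed
    ultimately have "local_partition \<Omega> l (ball p (r / 2)) C n (X \<times> {..<N}) P a"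
      unfolding local_partition_def by blast
    then show ?thesis by blast
  qed
  then show ?thesis using C0 by blast
qed

end

section \<open>Charts at every point, and the global partition\<close>

lemma interior_chart:
  fixes \<Omega> :: "((real ^ 'd::finite) \<times> real) set"
  assumes "compact \<Omega>" "p \<in> interior \<Omega>"
  shows "\<exists>f G M v r R. subgraph_chart f G M \<Omega> p v r R"
proof -
  obtain r where r: "0 < r" "ball p r \<subseteq> \<Omega>"
    using assms(2) mem_interior by metis
  have p: "p \<in> \<Omega>" using assms(2) interior_subset by blast
  have le: "snd x \<le> snd p + r" if "x \<in> ball p r" for x
  proof -
    have "\<bar>snd p - snd x\<bar> \<le> norm (p - x)"
      using norm_snd_le[of "snd (p - x)" "fst (p - x)"] unfolding prod.collapse by simp
    then show ?thesis using that by (simp add: dist_norm)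
  qed
  have "subgraph_chart (\<lambda>_. snd p + r) (\<lambda>_. 0) 0 \<Omega> p 0 r (\<lambda>x. x)"
    unfolding subgraph_chart_def subgraph_chart_axioms_def
    using C11_const assms(1) p r le by (auto simp: orthogonal_transformation)
  then show ?thesis by blast
qed

lemma boundary_chart:
  fixes \<Omega> :: "((real ^ 'd::finite) \<times> real) set"
  assumes "compact \<Omega>" "C2_domain \<Omega>" "p \<in> frontier \<Omega>"
  shows "\<exists>f G M v r R. subgraph_chart f G M \<Omega> p v r R"
proof -
  from assms(2)[unfolded C2_domain_def]
  obtain \<delta> M J and U :: "nat \<Rightarrow> ((real ^ 'd) \<times> real) set" where
    U: "\<forall>j\<in>{1..J}. open (U j) \<and> connected (U j)" "frontier \<Omega> \<subseteq> (\<Union>j\<in>{1..J}. U j)" and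
    "\<forall>x\<in>\<Omega>. infdist x (frontier \<Omega>) < \<delta> \<longrightarrow> (\<exists>j\<in>{1..J}. x \<in> U j \<and> infdist x (frontier (U j)) > \<delta>)" and
    ch: "\<forall>j\<in>{1..J}. \<exists>(R :: (real ^ 'd) \<times> real \<Rightarrow> (real ^ 'd) \<times> real) v (f :: real ^ 'd \<Rightarrow> real).
           orthogonal_transformation R \<and> C2_function f \<and>
           (\<forall>i k x. \<bar>partial_deriv i (partial_deriv k f) x\<bar> \<le> M) \<and>
           \<Omega> \<inter> U j = {x \<in> U j. snd (R (x - v)) \<le> f (fst (R (x - v)))}"
    by (elim exE conjE) (rule that)
  obtain j where j: "j \<in> {1..J}" "p \<in> U j" using U(2) assms(3) by blast
  obtain R :: "(real ^ 'd) \<times> real \<Rightarrow> (real ^ 'd) \<times> real" and v and f :: "real ^ 'd \<Rightarrow> real" where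
    "orthogonal_transformation R \<and> C2_function f \<and>
      (\<forall>i k x. \<bar>partial_deriv i (partial_deriv k f) x\<bar> \<le> M) \<and>
      \<Omega> \<inter> U j = {x \<in> U j. snd (R (x - v)) \<le> f (fst (R (x - v)))}"
    using bspec[OF ch j(1)] by (elim exE) (rule that)
  then have R: "orthogonal_transformation R" and f: "C2_function f"
    "\<forall>i k x. \<bar>partial_deriv i (partial_deriv k f) x\<bar> \<le> M"
    and eq: "\<Omega> \<inter> U j = {x \<in> U j. snd (R (x - v)) \<le> f (fst (R (x - v)))}"
    by blast+
  obtain G M' where G: "C11_function f G M'" using C11_of_C2[OF f(1) f(2)[rule_format]] by blast
  obtain r where r: "0 < r" "ball p r \<subseteq> U j" using U(1) j open_contains_ball by metis
  have p: "p \<in> \<Omega>" using assms(1,3) compact_imp_closed frontier_subset_closed by blast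
  have "\<Omega> \<inter> ball p r = (\<Omega> \<inter> U j) \<inter> ball p r" using r(2) by blast
  also have "\<dots> = {x \<in> ball p r. snd (R (x - v)) \<le> f (fst (R (x - v)))}"
    unfolding eq using r(2) by blast
  finally have "subgraph_chart f G M' \<Omega> p v r R"
    unfolding subgraph_chart_def subgraph_chart_axioms_def using G assms(1) p r R by blast
  then show ?thesis by blast
qed

theorem theorem2p9:
  fixes D \<Omega> :: "((real ^ 'd::finite) \<times> real) set" and l :: real
  assumes "open D" and "connected D" and "bounded D"
    and "\<Omega> = closure D"
    and "C2_domain \<Omega>"
    and "l > 1"
  shows "\<exists>c0>0. \<exists>C1>0. \<forall>n::nat. n \<ge> 1 \<longrightarrow>
    (\<exists>(m::nat) (\<xi> :: nat \<Rightarrow> (real ^ 'd) \<times> real) (P :: nat \<Rightarrow> (real ^ 'd) \<times> real \<Rightarrow> real).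
       inj_on \<xi> {1..m} \<and> \<xi> ` {1..m} \<subseteq> \<Omega> \<and>
       separated_wrt (rho \<Omega>) (1 / real n) (\<xi> ` {1..m}) \<and>
       (\<forall>j\<in>{1..m}. polynomial_degree_le (c0 * real n) (P j)) \<and>
       (\<forall>x\<in>\<Omega>. (\<Sum>j=1..m. P j x) = 1 \<and>
          (\<forall>j\<in>{1..m}. \<bar>P j x\<bar> \<le> C1 * (1 + real n * rho \<Omega> x (\<xi> j)) powr (- l))))"
proof (cases "\<Omega> = {}")
  case True
  then show ?thesis
    by (intro exI[of _ 1] conjI allI impI exI[of _ "0::nat"]) (auto simp: separated_wrt_def)
next
  case False
  have comp: "compact \<Omega>" using assms(3,4) by (simp add: compact_closure)
  have l: "0 < l" using assms(6) by simp
  have "\<exists>f G M v r R. subgraph_chart f G M \<Omega> p v r R" if "p \<in> \<Omega>" for p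
  proof (cases "p \<in> interior \<Omega>")
    case True
    then show ?thesis by (rule interior_chart[OF comp])
  next
    case False
    then have "p \<in> frontier \<Omega>" using that closure_subset by (auto simp: frontier_def)
    then show ?thesis by (rule boundary_chart[OF comp assms(5)])
  qed
  then have charts: "\<exists>f G M v r R. subgraph_chart f G M \<Omega> p v r R" if "p \<in> \<Omega>" for p using that by blast
  have "\<exists>r. \<forall>p\<in>\<Omega>. 0 < r p \<and> (\<exists>C\<ge>0. \<forall>n\<ge>1. \<exists>(I :: (('d \<Rightarrow> nat) \<times> nat) set) P a.
      local_partition \<Omega> l (ball p (r p / 2)) C n I P a)"
  proof (rule bchoice, rule ballI)
    fix p assume "p \<in> \<Omega>"
    then obtain f G M v r R where "subgraph_chart f G M \<Omega> p v r R" using charts by blast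
    then interpret subgraph_chart f G M \<Omega> p v r R .
    show "\<exists>r. 0 < r \<and> (\<exists>C\<ge>0. \<forall>n\<ge>1. \<exists>(I :: (('d \<Rightarrow> nat) \<times> nat) set) P a.
      local_partition \<Omega> l (ball p (r / 2)) C n I P a)"
      by (rule exI[of _ r], rule conjI[OF r_pos chart_partition[OF l]])
  qed
  then obtain r where r: "\<And>p. p \<in> \<Omega> \<Longrightarrow> 0 < r p"
    and loc: "\<And>p. p \<in> \<Omega> \<Longrightarrow> \<exists>C\<ge>0. \<forall>n\<ge>1. \<exists>(I :: (('d \<Rightarrow> nat) \<times> nat) set) P a.
      local_partition \<Omega> l (ball p (r p / 2)) C n I P a"
    by blast
  have "\<Omega> \<subseteq> (\<Union>p\<in>\<Omega>. ball p (r p / 4))" using r by force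
  then obtain Q where Q: "Q \<subseteq> \<Omega>" "finite Q" "\<Omega> \<subseteq> (\<Union>p\<in>Q. ball p (r p / 4))"
    using compactE_image[OF comp, of \<Omega> "\<lambda>p. ball p (r p / 4)"] by auto
  obtain q where q: "bij_betw q {..<card Q} Q"
    using Q(2) finite_same_card_bij[of "{..<card Q}" Q] by auto
  have q_in: "q j \<in> \<Omega>" if "j < card Q" for j using q that Q(1) by (auto simp: bij_betw_def)
  have "\<exists>C>0. \<forall>n\<ge>1. \<exists>(I :: (nat \<times> ('d \<Rightarrow> nat) \<times> nat) option set) P a. finite I \<and> a ` I \<subseteq> \<Omega> \<and>
     (\<forall>i\<in>I. polynomial_degree_le (C * real n) (P i)) \<and>
     (\<forall>x. (\<Sum>i\<in>I. P i x) = 1) \<and> (\<forall>x\<in>\<Omega>. decay_sum \<Omega> l n I P a x \<le> C)"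
  proof (rule glue_local_partitions[OF l, where J = "card Q" and p = q and r = "\<lambda>j. r (q j)"])
    show "bounded \<Omega>" using comp by (rule compact_imp_bounded)
    show "\<Omega> \<subseteq> (\<Union>j<card Q. ball (q j) (r (q j) / 4))"
    proof
      fix x assume "x \<in> \<Omega>"
      then obtain p where p: "p \<in> Q" "x \<in> ball p (r p / 4)" using Q(3) by blast
      have "p \<in> q ` {..<card Q}" using q p(1) by (simp add: bij_betw_def)
      then obtain j where "j < card Q" "q j = p" by blast
      then show "x \<in> (\<Union>j<card Q. ball (q j) (r (q j) / 4))" using p(2) by blast
    qed
    show "\<Omega> \<noteq> {}" by (rule False)
    fix j assume "j < card Q"
    then have "q j \<in> \<Omega>" by (rule q_in)
    then show "0 < r (q j)" "q j \<in> \<Omega>" "\<exists>C\<ge>0. \<forall>n\<ge>1. \<exists>(I :: (('d \<Rightarrow> nat) \<times> nat) set) P a.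
      local_partition \<Omega> l (ball (q j) (r (q j) / 2)) C n I P a"
      by (blast intro: r, assumption, rule loc)
  qed
  then obtain C where C: "0 < C" and fam: "\<forall>n\<ge>1. \<exists>(I :: (nat \<times> ('d \<Rightarrow> nat) \<times> nat) option set) P a. finite I \<and> a ` I \<subseteq> \<Omega> \<and>
     (\<forall>i\<in>I. polynomial_degree_le (C * real n) (P i)) \<and>
     (\<forall>x. (\<Sum>i\<in>I. P i x) = 1) \<and> (\<forall>x\<in>\<Omega>. decay_sum \<Omega> l n I P a x \<le> C)"
    by blast
  show ?thesis
  proof (rule exI[of _ C], rule conjI[OF C], rule exI[of _ "2 powr l * C"], intro conjI allI impI)
    show "0 < 2 powr l * C" using C by simp
    fix n :: nat assume n: "1 \<le> n"
    obtain I :: "(nat \<times> ('d \<Rightarrow> nat) \<times> nat) option set" and P a where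
      IPa: "finite I \<and> a ` I \<subseteq> \<Omega> \<and> (\<forall>i\<in>I. polynomial_degree_le (C * real n) (P i)) \<and>
        (\<forall>x. (\<Sum>i\<in>I. P i x) = 1) \<and> (\<forall>x\<in>\<Omega>. decay_sum \<Omega> l n I P a x \<le> C)"
      using fam[rule_format, OF n] by (elim exE) (rule that)
    show "\<exists>(m::nat) (\<xi> :: nat \<Rightarrow> (real ^ 'd) \<times> real) (P :: nat \<Rightarrow> (real ^ 'd) \<times> real \<Rightarrow> real).
       inj_on \<xi> {1..m} \<and> \<xi> ` {1..m} \<subseteq> \<Omega> \<and>
       separated_wrt (rho \<Omega>) (1 / real n) (\<xi> ` {1..m}) \<and>
       (\<forall>j\<in>{1..m}. polynomial_degree_le (C * real n) (P j)) \<and>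
       (\<forall>x\<in>\<Omega>. (\<Sum>j=1..m. P j x) = 1 \<and>
          (\<forall>j\<in>{1..m}. \<bar>P j x\<bar> \<le> 2 powr l * C * (1 + real n * rho \<Omega> x (\<xi> j)) powr (- l)))"
    proof (rule separated_partition[where I = I and a = a and P = P])
      show "0 \<le> l" "1 \<le> n" "0 \<le> C" using l n C by simp_all
    qed (use IPa in blast)+
  qed
qed

end
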